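(* With the notation of the context, \[ \mathbb{H}_{\rm add}^{1,=}=\mathbb{H}_0 \prec \mathbb{H}_1 \prec \mathbb{H}_2\prec\cdots \prec \mathbb{H}_k\prec\cdots \prec \bigcup_{i\geq 1}\mathbb{H}_i \preceq \mathbb{H}_{\rm add}^{1}, \] i.e. $\mathbb{H}_k\prec\mathbb{H}_{k+1}$ and $\mathbb{H}_k\prec\bigcup_{i\ge1}\mathbb{H}_i$ for every $k\in\mathbb{N}$, and $\bigcup_{i\ge1}\mathbb{H}_i\preceq\mathbb{H}^1_{\rm add}$.
   Context: Model. An additive BSS RAM has real registers $Z_1,Z_2,\ldots$ and finitely many index registers $I_1,\ldots,I_k$ (holding positive integers). Its program is a finite labelled list of instructions of the forms $Z_i:=Z_j+Z_k$, $Z_i:=Z_j-Z_k$, $Z_j:=c$ ($c$ a constant), "if $Z_j=0$ then goto $l_1$ else goto $l_2$", "if $Z_j\geq 0$ then goto $l_1$ else goto $l_2$", $Z_{I_j}:=Z_{I_k}$, $I_j:=1$, $I_j:=I_j+1$, "if $I_j=I_k$ then goto $l_1$ else goto $l_2$", together with halting/output. Inputs are tuples $(x_1,\ldots,x_n)\in\mathbb{R}^\infty=\bigcup_{n\ge1}\mathbb{R}^n$, loaded by $Z_i:=x_i$ and setting every index register to $n$. $\mathsf{M}^1_{\rm add}$: such machines using only constants $0,1$; $\mathsf{M}^{1,=}_{\rm add}$: only constants $0,1$ and only equality tests. For $\mathcal{O}\subseteq\mathbb{R}^\infty$, machines in $\mathsf{M}^1_{\rm add}(\mathcal{O})$ may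 additionally execute "if $(Z_1,\ldots,Z_{I_1})\in\mathcal{O}$ then goto $l_1$ else goto $l_2$". A set is semi-decidable by a class if it is the halting set of a machine in it; decidable if its characteristic function is computed by a machine in it. For $\mathcal{A},\mathcal{B}\subseteq\mathbb{R}^\infty$: $\mathcal{A}\preceq\mathcal{B}$ iff $\mathcal{A}$ is decidable by a machine in $\mathsf{M}^1_{\rm add}(\mathcal{B})$; $\mathcal{A}\prec\mathcal{B}$ iff $\mathcal{A}\preceq\mathcal{B}$ and not $\mathcal{B}\preceq\mathcal{A}$. Halting problems: for $\mathsf{C}\in\{\mathsf{M}^{1,=}_{\rm add},\mathsf{M}^1_{\rm add}\}$, $\bigcup_{n\ge1}\{(n,x_1,\ldots,x_n,s_1,\ldots,s_m)\mid (x_1,\ldots,x_n)\in\mathbb{R}^n,\ \mathcal{M}\in\mathsf{C},\ \mathcal{M}\text{ halts on }(x_1,\ldots,x_n)\}$, where $(s_1,\ldots,s_m)\in\{0,1\}^m$ is the fixed binary code of the program of $\mathcal{M}$; these are $\mathbb{H}^{1,=}_{\rm add}$ and $\mathbb{H}^1_{\rm add}$ respectively. Let $p_1=2,p_2=3,\ldots$ be the primes in increasing order. Let $\mathcal{K}\in\mathsf{M}^1_{\rm add}$ be the fixed machine which on input $(i,x)$ ($i\in\mathbb{N}_+$, $x\in\mathbb{R}$) computes $p_i$, enumerates all pairs $(r,q)\in\mathbb{N}\times\mathbb{N}_+$ and halts as soon as ($x<r/q$ and $r^2/q^2<p_i$) or ($x>r/q$ and $r^2/q^2>p_i$); so it halts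 on $(i,x)$ iff $x\neq\sqrt{p_i}$. Let ${\rm code}(\mathcal{K})=(s_1,\ldots,s_m)$. For $i\ge1$, $\mathbb{P}_i=\{(2,i,x,s_1,\ldots,s_m)\mid x\in\mathbb{R}\setminus\{\sqrt{p_i}\}\}$. Put $\mathbb{H}_0=\mathbb{H}^{1,=}_{\rm add}$ and $\mathbb{H}_i=\mathbb{H}^{1,=}_{\rm add}\cup\bigcup_{j\le i}\mathbb{P}_j$ for $i\ge1$. *)

theory Defs
  imports Complex_Main "HOL-Computational_Algebra.Primes" "HOL-Library.Infinite_Set"
begin

section \<open>Additive BSS RAMs\<close>

text \<open>
  Registers \<open>Z\<^sub>1, Z\<^sub>2, \<dots>\<close> and index registers \<open>I\<^sub>1, I\<^sub>2, \<dots>\<close> are numbered from 1, as enforced by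
  \<open>wf_prog\<close> below.  Labels are positions in the instruction list, counted from 0.
\<close>

datatype instr =
    Add nat nat nat           \<comment> \<open>\<open>Z\<^sub>i := Z\<^sub>j + Z\<^sub>k\<close>\<close>
  | Sub nat nat nat           \<comment> \<open>\<open>Z\<^sub>i := Z\<^sub>j - Z\<^sub>k\<close>\<close>
  | SetConst nat real         \<comment> \<open>\<open>Z\<^sub>j := c\<close>\<close>
  | IfZero nat nat nat        \<comment> \<open>if \<open>Z\<^sub>j = 0\<close> then goto \<open>l\<^sub>1\<close> else goto \<open>l\<^sub>2\<close>\<close>
  | IfNonneg nat nat nat      \<comment> \<open>if \<open>Z\<^sub>j \<ge> 0\<close> then goto \<open>l\<^sub>1\<close> else goto \<open>l\<^sub>2\<close>\<close>
  | Copy nat nat              \<comment> \<open>\<open>Z\<close> at address \<open>I\<^sub>j\<close> \<open>:=\<close> \<open>Z\<close> at address \<open>I\<^sub>k\<close>\<close>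
  | IdxOne nat                \<comment> \<open>\<open>I\<^sub>j := 1\<close>\<close>
  | IdxInc nat                \<comment> \<open>\<open>I\<^sub>j := I\<^sub>j + 1\<close>\<close>
  | IfIdxEq nat nat nat nat   \<comment> \<open>if \<open>I\<^sub>j = I\<^sub>k\<close> then goto \<open>l\<^sub>1\<close> else goto \<open>l\<^sub>2\<close>\<close>
  | IfOracle nat nat          \<comment> \<open>if \<open>(Z\<^sub>1, \<dots>, Z\<close> at \<open>I\<^sub>1)\<close> is in the oracle then goto \<open>l\<^sub>1\<close> else goto \<open>l\<^sub>2\<close>\<close>
  | Stop

type_synonym prog = "instr list"

text \<open>A configuration consists of the current label, the index registers and the real registers.\<close>

type_synonym config = "nat \<times> (nat \<Rightarrow> nat) \<times> (nat \<Rightarrow> real)"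

definition contents :: "(nat \<Rightarrow> nat) \<Rightarrow> (nat \<Rightarrow> real) \<Rightarrow> real list" where
  "contents I Z = map Z [1..<Suc (I 1)]"

fun step :: "real list set \<Rightarrow> prog \<Rightarrow> config \<Rightarrow> config" where
  "step Q p (l, I, Z) = (case p ! l of
      Add i j k \<Rightarrow> (Suc l, I, Z(i := Z j + Z k))
    | Sub i j k \<Rightarrow> (Suc l, I, Z(i := Z j - Z k))
    | SetConst j c \<Rightarrow> (Suc l, I, Z(j := c))
    | IfZero j l1 l2 \<Rightarrow> (if Z j = 0 then l1 else l2, I, Z)
    | IfNonneg j l1 l2 \<Rightarrow> (if Z j \<ge> 0 then l1 else l2, I, Z)
    | Copy j k \<Rightarrow> (Suc l, I, Z(I j := Z (I k)))
    | IdxOne j \<Rightarrow> (Suc l, I(j := 1), Z)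
    | IdxInc j \<Rightarrow> (Suc l, I(j := I j + 1), Z)
    | IfIdxEq j k l1 l2 \<Rightarrow> (if I j = I k then l1 else l2, I, Z)
    | IfOracle l1 l2 \<Rightarrow> (if contents I Z \<in> Q then l1 else l2, I, Z)
    | Stop \<Rightarrow> (l, I, Z))"

text \<open>
  Real registers beyond the input hold 0 initially.  All index registers hold the input length;
  a program mentions only finitely many of them.
\<close>

definition load :: "real list \<Rightarrow> nat \<Rightarrow> real" where
  "load xs i = (if 1 \<le> i \<and> i \<le> length xs then xs ! (i - 1) else 0)"

definition init :: "real list \<Rightarrow> config" where
  "init xs = (0, (\<lambda>_. length xs), load xs)"

definition computes :: "real list set \<Rightarrow> prog \<Rightarrow> real list \<Rightarrow> real list \<Rightarrow> bool" where
  "computes Q p xs ys \<longleftrightarrow>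
     (\<exists>n l I Z. (step Q p ^^ n) (init xs) = (l, I, Z) \<and> p ! l = Stop \<and> ys = contents I Z)"

definition halts_on :: "prog \<Rightarrow> real list \<Rightarrow> bool" where
  "halts_on p xs \<longleftrightarrow> (\<exists>ys. computes {} p xs ys)"

fun wf_instr :: "nat \<Rightarrow> instr \<Rightarrow> bool" where
  "wf_instr n (Add i j k) \<longleftrightarrow> i \<ge> 1 \<and> j \<ge> 1 \<and> k \<ge> 1"
| "wf_instr n (Sub i j k) \<longleftrightarrow> i \<ge> 1 \<and> j \<ge> 1 \<and> k \<ge> 1"
| "wf_instr n (SetConst j c) \<longleftrightarrow> j \<ge> 1"
| "wf_instr n (IfZero j l1 l2) \<longleftrightarrow> j \<ge> 1 \<and> l1 < n \<and> l2 < n"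
| "wf_instr n (IfNonneg j l1 l2) \<longleftrightarrow> j \<ge> 1 \<and> l1 < n \<and> l2 < n"
| "wf_instr n (Copy j k) \<longleftrightarrow> j \<ge> 1 \<and> k \<ge> 1"
| "wf_instr n (IdxOne j) \<longleftrightarrow> j \<ge> 1"
| "wf_instr n (IdxInc j) \<longleftrightarrow> j \<ge> 1"
| "wf_instr n (IfIdxEq j k l1 l2) \<longleftrightarrow> j \<ge> 1 \<and> k \<ge> 1 \<and> l1 < n \<and> l2 < n"
| "wf_instr n (IfOracle l1 l2) \<longleftrightarrow> l1 < n \<and> l2 < n"
| "wf_instr n Stop \<longleftrightarrow> True"

text \<open>Since the last instruction is \<open>Stop\<close>, the current label never leaves the program.\<close>

definition wf_prog :: "prog \<Rightarrow> bool" where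
  "wf_prog p \<longleftrightarrow> p \<noteq> [] \<and> last p = Stop \<and> (\<forall>a \<in> set p. wf_instr (length p) a)"

text \<open>
  The programs of the machines in \<open>M\<^sup>1\<^sub>a\<^sub>d\<^sub>d(Q)\<close>; they do not depend on the oracle set \<open>Q\<close>,
  which enters as a parameter of \<open>step\<close>.
\<close>

definition M1_add_oracle :: "prog set" where
  "M1_add_oracle = {p. wf_prog p \<and> (\<forall>j c. SetConst j c \<in> set p \<longrightarrow> c \<in> {0, 1})}"

definition M1_add :: "prog set" where
  "M1_add = {p \<in> M1_add_oracle. \<forall>l1 l2. IfOracle l1 l2 \<notin> set p}"

definition M1_eq_add :: "prog set" where
  "M1_eq_add = {p \<in> M1_add. \<forall>j l1 l2. IfNonneg j l1 l2 \<notin> set p}"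

section \<open>Reducibility\<close>

text \<open>Inputs are the nonempty lists of reals, representing the union of all \<open>\<real>\<^sup>n\<close> with \<open>n \<ge> 1\<close>.\<close>

definition reducible :: "real list set \<Rightarrow> real list set \<Rightarrow> bool"  (infix "\<preceq>" 50) where
  "A \<preceq> B \<longleftrightarrow>
     (\<exists>p \<in> M1_add_oracle. \<forall>xs. xs \<noteq> [] \<longrightarrow> computes B p xs [if xs \<in> A then 1 else 0])"

definition strictly_reducible :: "real list set \<Rightarrow> real list set \<Rightarrow> bool"  (infix "\<prec>" 50) where
  "A \<prec> B \<longleftrightarrow> A \<preceq> B \<and> \<not> B \<preceq> A"

section \<open>Halting problems\<close>

text \<open>
  The binary code of an instruction lists an opcode and the operands, each number \<open>n\<close> being
  written in the self-delimiting form \<open>1\<^sup>n0\<close>.  Only programs with constants 0 and 1 are encoded,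
  so a constant takes one bit of information.
\<close>

fun instr_fields :: "instr \<Rightarrow> nat list" where
  "instr_fields Stop = [0]"
| "instr_fields (Add i j k) = [1, i, j, k]"
| "instr_fields (Sub i j k) = [2, i, j, k]"
| "instr_fields (SetConst j c) = [3, j, if c = 0 then 0 else 1]"
| "instr_fields (IfZero j l1 l2) = [4, j, l1, l2]"
| "instr_fields (IfNonneg j l1 l2) = [5, j, l1, l2]"
| "instr_fields (Copy j k) = [6, j, k]"
| "instr_fields (IdxOne j) = [7, j]"
| "instr_fields (IdxInc j) = [8, j]"
| "instr_fields (IfIdxEq j k l1 l2) = [9, j, k, l1, l2]"
| "instr_fields (IfOracle l1 l2) = [10, l1, l2]"

definition nat_code :: "nat \<Rightarrow> real list" where
  "nat_code n = replicate n 1 @ [0]"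

definition code :: "prog \<Rightarrow> real list" where
  "code p = concat (map nat_code (concat (map instr_fields p)))"

definition halting_problem :: "prog set \<Rightarrow> real list set" where
  "halting_problem C =
     {real n # xs @ code p | n xs p. n \<ge> 1 \<and> length xs = n \<and> p \<in> C \<and> halts_on p xs}"

definition H1_add :: "real list set" where
  "H1_add = halting_problem M1_add"

definition H1_eq_add :: "real list set" where
  "H1_eq_add = halting_problem M1_eq_add"

section \<open>The hierarchy\<close>

text \<open>\<open>nth_prime i\<close> is \<open>p\<^sub>i\<close>, so \<open>nth_prime 1 = 2\<close>.\<close>

definition nth_prime :: "nat \<Rightarrow> nat" where
  "nth_prime i = enumerate {p. prime p} (i - 1)"

text \<open>
  The program of the machine \<open>\<K>\<close>.  The input \<open>(i, x)\<close> is in \<open>Z\<^sub>1, Z\<^sub>2\<close>.  Register use: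
  \<open>Z\<^sub>3 = 1\<close>, \<open>Z\<^sub>4\<close> the prime candidate \<open>p\<close>, \<open>Z\<^sub>5\<close> a trial divisor, \<open>Z\<^sub>6\<close> its multiples,
  \<open>Z\<^sub>7\<close> scratch, \<open>Z\<^sub>8 = r\<close>, \<open>Z\<^sub>9 = q\<close>, \<open>Z\<^bsub>10\<^esub>\<close> a loop counter,
  \<open>Z\<^bsub>11\<^esub> = qx\<close> and then \<open>r - qx\<close>, \<open>Z\<^bsub>12\<^esub> = q\<^sup>2\<close>, \<open>Z\<^bsub>13\<^esub> = r\<^sup>2\<close>,
  \<open>Z\<^bsub>14\<^esub> = pq\<^sup>2\<close> and then \<open>pq\<^sup>2 - r\<^sup>2\<close>.
  The pairs \<open>(r, q)\<close> are enumerated by increasing \<open>r + q\<close>, for equal sums by increasing \<open>q\<close>.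
  The unconditional jumps have the form \<open>IfZero 7 l l\<close>.
\<close>

definition machine_K :: prog where
  "machine_K = [
     \<comment> \<open>0: compute \<open>p = p\<^sub>i\<close>, decreasing \<open>Z\<^sub>1\<close> at each prime\<close>
     SetConst 3 1, SetConst 4 1,
     \<comment> \<open>2: next candidate; 4: next trial divisor; 7: next multiple\<close>
     Add 4 4 3, Add 5 3 3,
     Sub 7 4 5, IfZero 7 13 6, SetConst 6 0,
     Add 6 6 5, Sub 7 4 6, IfZero 7 2 10, IfNonneg 7 7 11,
     Add 5 5 3, IfZero 7 4 4,
     \<comment> \<open>13: \<open>p\<close> is prime\<close>
     Sub 1 1 3, IfZero 1 15 2,
     \<comment> \<open>15: \<open>r := 0\<close>; 16: \<open>q := 1\<close>\<close>
     SetConst 8 0, SetConst 9 1,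
     \<comment> \<open>17: compute \<open>qx\<close> and \<open>q\<^sup>2\<close>\<close>
     SetConst 10 0, SetConst 11 0, SetConst 12 0,
     Add 11 11 2, Add 12 12 9, Add 10 10 3, Sub 7 9 10, IfZero 7 25 20,
     \<comment> \<open>25: compute \<open>r\<^sup>2\<close>\<close>
     SetConst 10 0, SetConst 13 0,
     Sub 7 8 10, IfZero 7 32 29, Add 13 13 8, Add 10 10 3, IfZero 7 27 27,
     \<comment> \<open>32: compute \<open>pq\<^sup>2\<close>\<close>
     SetConst 10 0, SetConst 14 0,
     Add 14 14 12, Add 10 10 3, Sub 7 4 10, IfZero 7 38 34,
     \<comment> \<open>38: stop if \<open>r - qx\<close> and \<open>pq\<^sup>2 - r\<^sup>2\<close> are both positive or both negative\<close>
     Sub 11 8 11, Sub 14 14 13,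
     IfZero 11 45 41, IfZero 14 45 42, IfNonneg 11 43 44, IfNonneg 14 51 45, IfNonneg 14 45 51,
     \<comment> \<open>45: next pair: from \<open>(0, q)\<close> to \<open>(q, 1)\<close>, otherwise from \<open>(r, q)\<close> to \<open>(r - 1, q + 1)\<close>\<close>
     IfZero 8 46 48, Add 8 9 8, IfZero 7 16 16, Sub 8 8 3, Add 9 9 3, IfZero 7 17 17,
     Stop]"

definition P_set :: "nat \<Rightarrow> real list set" where
  "P_set i =
     {[2, real i, x] @ code machine_K | x. x \<in> UNIV - {sqrt (real (nth_prime i))}}"

definition H :: "nat \<Rightarrow> real list set" where
  "H i = H1_eq_add \<union> (\<Union>j\<in>{1..i}. P_set j)"

end

theory Submission
  imports Defs "HOL-Library.Product_Plus"
begin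

text \<open>
  Lower bounds: put \<open>x\<^sub>0 = sqrt p\<^bsub>k+1\<^esub>\<close>.  On the inputs \<open>(2, k+1, x) @ code \<K>\<close> every register always holds
  a form \<open>a + b x\<close> with integers \<open>a, b\<close>.  For \<open>x \<in> x\<^sub>0 + \<rat>\<close> an equality test on such forms, and hence
  membership of a tuple of forms in \<open>H k\<close>, does not depend on \<open>x\<close>: all these \<open>x\<close> are irrational and
  no form represents \<open>sqrt p\<^sub>j\<close> for \<open>j \<le> k\<close>.  Order tests are constant near \<open>x\<^sub>0\<close>, so a machine with
  oracle \<open>H k\<close> gives the same answer for \<open>x\<^sub>0\<close> and for some \<open>x \<noteq> x\<^sub>0\<close>, although only the latter input
  belongs to \<open>H (k+1)\<close>.

  Reductions: a single oracle query decides whether the input lies in the larger set, in which case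
  the input is known to be \<open>(n, x\<^sub>1, \<dots>, x\<^sub>n) @ code p\<close>, and a finite automaton run on \<open>code p\<close> decides
  whether \<open>p\<close> contains an order test and whether \<open>code p = code \<K>\<close>.
\<close>

section \<open>Runs of machines\<close>

text \<open>Rational shifts of \<open>x0\<close> serve two ends: they are dense, so points other
  than \<open>x0\<close> lie in every interval on which finitely many order tests are constant, and
  they stay in the field generated by \<open>x0\<close>, which contains no square root of another
  prime. One finite run suffices, since the interval may shrink with each step and the halting run
  at \<open>x0\<close> has a fixed length. In the reductions a negative oracle answer is final,
  because the smaller set is contained in the larger. A positive answer supplies what a machine
  would otherwise have to establish: the first entry is a positive integer, so counting it down
  terminates, and the tuple ends in a genuine program code. For the union below
  \<open>H1_add\<close> no index is inspected: \<open>machine_K\<close> halts on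
  \<open>(a, x)\<close> only if \<open>a\<close> is a positive integer, which is why its behaviour
  on arbitrary real \<open>a\<close> is analysed as well.\<close>

definition leads :: "real list set \<Rightarrow> prog \<Rightarrow> config \<Rightarrow> (config \<Rightarrow> bool) \<Rightarrow> bool" where
  "leads Q p c P \<longleftrightarrow> (\<exists>n. P ((step Q p ^^ n) c))"

lemma leads_now: "P c \<Longrightarrow> leads Q p c P"
  unfolding leads_def by (rule exI[of _ 0]) simp

lemma leads_step: "leads Q p (step Q p c) P \<Longrightarrow> leads Q p c P"
  unfolding leads_def by (metis comp_apply funpow_Suc_right)

lemma leads_trans:
  assumes "leads Q p c P" "\<And>c'. P c' \<Longrightarrow> leads Q p c' R"
  shows "leads Q p c R"
proof -
  obtain n where "P ((step Q p ^^ n) c)"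
    using assms(1) by (auto simp: leads_def)
  then obtain m where "R ((step Q p ^^ m) ((step Q p ^^ n) c))"
    using assms(2)[unfolded leads_def] by blast
  then show ?thesis
    unfolding leads_def by (metis comp_apply funpow_add)
qed

definition stopped :: "prog \<Rightarrow> config \<Rightarrow> bool" where
  "stopped p c \<longleftrightarrow> p ! fst c = Stop"

lemma computes_iff_leads:
  "computes Q p xs ys \<longleftrightarrow>
     leads Q p (init xs) (\<lambda>(l, I, Z). p ! l = Stop \<and> ys = contents I Z)"
  unfolding computes_def leads_def by (simp add: split_beta) (metis prod.collapse fst_conv snd_conv)

lemma halts_on_iff_leads: "halts_on p xs \<longleftrightarrow> leads {} p (init xs) (stopped p)"
  unfolding halts_on_def computes_def leads_def stopped_def by (metis prod.collapse fst_conv)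

lemma stopped_funpow: "stopped p c \<Longrightarrow> (step Q p ^^ n) c = c"
  by (induction n) (cases c; auto simp: stopped_def)+

text \<open>Runs are deterministic and \<open>Stop\<close> is a fixed point of \<open>step\<close>,
  so the longer of two halting runs ends where the shorter one does.\<close>

lemma computes_unique:
  assumes "computes Q p xs ys" "computes Q p xs zs"
  shows "ys = zs"
proof -
  have *: "ys = zs" if "m \<le> n"
    and m: "(step Q p ^^ m) (init xs) = (l, I, Z)" "p ! l = Stop" "ys = contents I Z"
    and n: "(step Q p ^^ n) (init xs) = (l', I', Z')" "zs = contents I' Z'"
    for m n l I Z l' I' Z' ys zs
  proof -
    have "(step Q p ^^ n) (init xs) = (step Q p ^^ (n - m)) ((step Q p ^^ m) (init xs))"
      using \<open>m \<le> n\<close> by (metis comp_apply funpow_add le_add_diff_inverse2)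
    then have "(step Q p ^^ n) (init xs) = (l, I, Z)"
      using m by (simp add: stopped_funpow stopped_def)
    then show ?thesis
      using m n by simp
  qed
  from assms show ?thesis
    unfolding computes_def using * by (metis nat_le_linear)
qed

text \<open>\<open>Inv\<close> need only recur, for instance at a loop head. Starting
  \<open>leads\<close> at \<open>step Q p c\<close> forces at least one step between two visits, so
  visits occur arbitrarily late, whereas a stopped run is frozen.\<close>

lemma not_leads_stopped:
  assumes "Inv c"
    and not_stopped: "\<And>c. Inv c \<Longrightarrow> \<not> stopped p c"
    and progress: "\<And>c. Inv c \<Longrightarrow> leads Q p (step Q p c) Inv"
  shows "\<not> leads Q p c (stopped p)"
proof
  assume "leads Q p c (stopped p)"
  then obtain t where "stopped p ((step Q p ^^ t) c)"
    by (auto simp: leads_def)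
  with \<open>Inv c\<close> show False
  proof (induction t arbitrary: c rule: less_induct)
    case (less t)
    obtain n where n: "Inv ((step Q p ^^ Suc n) c)"
      using progress[OF less.prems(1)] unfolding leads_def
      by (metis comp_apply funpow_Suc_right)
    show False
    proof (cases "Suc n \<le> t")
      case True
      then have "(step Q p ^^ t) c = (step Q p ^^ (t - Suc n)) ((step Q p ^^ Suc n) c)"
        by (metis comp_apply funpow_add le_add_diff_inverse2)
      then show False
        using less.IH[of "t - Suc n"] n less.prems(2) True by simp
    next
      \<comment> \<open>The run has stopped by the time of the next visit, so the configuration
        visited is itself a stopped one.\<close>
      case False
      then have "(step Q p ^^ Suc n) c = (step Q p ^^ (Suc n - t)) ((step Q p ^^ t) c)"
        by (metis comp_apply funpow_add le_add_diff_inverse2 nat_le_linear)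
      then have "(step Q p ^^ Suc n) c = (step Q p ^^ t) c"
        using less.prems(2) stopped_funpow by simp
      then show False
        using n less.prems(2) not_stopped by metis
    qed
  qed
qed

text \<open>Keeps \<open>p ! l\<close> an actual instruction of \<open>p\<close>, so that
  restrictions on the elements of \<open>set p\<close> apply to every executed instruction.\<close>

lemma wf_prog_step:
  assumes "wf_prog p" "l < length p"
  shows "fst (step Q p (l, I, Z)) < length p"
proof -
  have wf: "wf_instr (length p) (p ! l)"
    using assms by (auto simp: wf_prog_def)
  have "Suc l < length p" if "p ! l \<noteq> Stop"
    using assms that by (metis Suc_lessI diff_Suc_1 last_conv_nth wf_prog_def)
  then show ?thesis
    using wf assms(2) by (cases "p ! l") auto
qed

section \<open>The machine \<open>\<K>\<close>\<close>

lemma machine_K_nth: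
  "machine_K ! 0 = SetConst 3 1" "machine_K ! Suc 0 = SetConst 4 1"
  "machine_K ! 2 = Add 4 4 3" "machine_K ! 3 = Add 5 3 3"
  "machine_K ! 4 = Sub 7 4 5" "machine_K ! 5 = IfZero 7 13 6" "machine_K ! 6 = SetConst 6 0"
  "machine_K ! 7 = Add 6 6 5" "machine_K ! 8 = Sub 7 4 6" "machine_K ! 9 = IfZero 7 2 10"
  "machine_K ! 10 = IfNonneg 7 7 11"
  "machine_K ! 11 = Add 5 5 3" "machine_K ! 12 = IfZero 7 4 4"
  "machine_K ! 13 = Sub 1 1 3" "machine_K ! 14 = IfZero 1 15 2"
  "machine_K ! 15 = SetConst 8 0" "machine_K ! 16 = SetConst 9 1"
  "machine_K ! 17 = SetConst 10 0" "machine_K ! 18 = SetConst 11 0" "machine_K ! 19 = SetConst 12 0"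
  "machine_K ! 20 = Add 11 11 2" "machine_K ! 21 = Add 12 12 9" "machine_K ! 22 = Add 10 10 3"
  "machine_K ! 23 = Sub 7 9 10" "machine_K ! 24 = IfZero 7 25 20"
  "machine_K ! 25 = SetConst 10 0" "machine_K ! 26 = SetConst 13 0"
  "machine_K ! 27 = Sub 7 8 10" "machine_K ! 28 = IfZero 7 32 29" "machine_K ! 29 = Add 13 13 8"
  "machine_K ! 30 = Add 10 10 3" "machine_K ! 31 = IfZero 7 27 27"
  "machine_K ! 32 = SetConst 10 0" "machine_K ! 33 = SetConst 14 0"
  "machine_K ! 34 = Add 14 14 12" "machine_K ! 35 = Add 10 10 3" "machine_K ! 36 = Sub 7 4 10"
  "machine_K ! 37 = IfZero 7 38 34"
  "machine_K ! 38 = Sub 11 8 11" "machine_K ! 39 = Sub 14 14 13"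
  "machine_K ! 40 = IfZero 11 45 41" "machine_K ! 41 = IfZero 14 45 42"
  "machine_K ! 42 = IfNonneg 11 43 44" "machine_K ! 43 = IfNonneg 14 51 45"
  "machine_K ! 44 = IfNonneg 14 45 51"
  "machine_K ! 45 = IfZero 8 46 48" "machine_K ! 46 = Add 8 9 8" "machine_K ! 47 = IfZero 7 16 16"
  "machine_K ! 48 = Sub 8 8 3" "machine_K ! 49 = Add 9 9 3" "machine_K ! 50 = IfZero 7 17 17"
  "machine_K ! 51 = Stop"
  by (simp_all add: machine_K_def)

lemma machine_K_in_M1_add: "machine_K \<in> M1_add"
  by (auto simp: M1_add_def M1_add_oracle_def wf_prog_def machine_K_def)

abbreviation K_leads :: "config \<Rightarrow> (config \<Rightarrow> bool) \<Rightarrow> bool" where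
  "K_leads \<equiv> leads {} machine_K"

section \<open>Search for the prime with a given index\<close>

text \<open>Repeated addition replaces division: the multiples of \<open>d\<close> either hit
  \<open>c\<close>, which makes \<open>d\<close> a divisor, or jump over it, which makes the
  difference in register 7 negative.\<close>

lemma K_multiples:
  assumes "Z 4 = real c" "Z 5 = real d" "Z 6 = real (d * m)" "d \<ge> 1" "d * m < c"
  shows "K_leads (7, I, Z) (\<lambda>(l, _, Z').
    (\<forall>i\<in>{1,2,3,4,5}. Z' i = Z i) \<and> l = (if d dvd c then 2 else 11))"
  using assms
proof (induction "c - d * m" arbitrary: Z I m rule: less_induct)
  case less
  let ?Z = "Z(6 := real (d * Suc m), 7 := real c - real (d * Suc m))"
  have s: "step {} machine_K (step {} machine_K (7, I, Z)) = (9, I, ?Z)"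
    using less.prems by (simp add: machine_K_nth fun_eq_iff algebra_simps)
  consider "d * Suc m = c" | "d * Suc m < c" | "d * Suc m > c" by linarith
  then show ?case
  proof cases
    case 1
    then have "d dvd c" by auto
    show ?thesis
      apply (rule leads_step, rule leads_step, subst s)
      apply (rule leads_step, rule leads_now)
      using 1 \<open>d dvd c\<close> by (auto simp: machine_K_nth)
  next
    case 2
    have "real (d * Suc m) < real c" using 2 by linarith
    have ih: "K_leads (7, I, ?Z) (\<lambda>(l, _, Z').
       (\<forall>i\<in>{1,2,3,4,5}. Z' i = ?Z i) \<and> l = (if d dvd c then 2 else 11))"
      by (rule less.hyps[of "Suc m"]) (use less.prems 2 in auto)
    show ?thesis
      apply (rule leads_step, rule leads_step, subst s)
      apply (rule leads_step, rule leads_step)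
      using \<open>real (d * Suc m) < real c\<close> ih
      by (simp add: machine_K_nth)
  next
    case 3
    have "real (d * Suc m) > real c" using 3 by linarith
    have "\<not> d dvd c"
      using 3 less.prems by (metis dvdE less_eq_Suc_le linorder_not_less mult_less_cancel1)
    show ?thesis
      apply (rule leads_step, rule leads_step, subst s)
      apply (rule leads_step, rule leads_step, rule leads_now)
      using \<open>real (d * Suc m) > real c\<close> \<open>\<not> d dvd c\<close>
      by (auto simp: machine_K_nth)
  qed
qed

text \<open>A first divisor \<open>d < c\<close> sends the run to label 2 for the next candidate;
  reaching \<open>d = c\<close> means that nothing from 2 to \<open>c - 1\<close> divides
  \<open>c\<close>.\<close>

lemma K_trial_division:
  assumes "Z 3 = 1" "Z 4 = real c" "Z 5 = real d" "2 \<le> d" "d \<le> c"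
    and "\<forall>e. 2 \<le> e \<and> e < d \<longrightarrow> \<not> e dvd c"
  shows "K_leads (4, I, Z) (\<lambda>(l, _, Z').
    (\<forall>i\<in>{1,2,3,4}. Z' i = Z i) \<and> l = (if prime c then 13 else 2))"
  using assms
proof (induction "c - d" arbitrary: Z I d rule: less_induct)
  case less
  show ?case
  proof (cases "d = c")
    case True
    have "prime c"
      unfolding prime_nat_iff
    proof (intro conjI allI impI)
      fix e assume "e dvd c"
      moreover have "e \<le> c" "e \<noteq> 0"
        using \<open>e dvd c\<close> less.prems True by (auto dest: dvd_imp_le)
      ultimately show "e = 1 \<or> e = c"
        using less.prems(6) True by (cases "2 \<le> e \<and> e < d") auto
    qed (use less.prems True in simp)
    then show ?thesis
      apply -
      apply (rule leads_step, rule leads_step, rule leads_now)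
      using less.prems True by (auto simp: machine_K_nth)
  next
    case False
    then have lt: "d < c" using less.prems by simp
    let ?Z = "Z(7 := real c - real d, 6 := 0)"
    have l: "K_leads (7, I, ?Z) (\<lambda>(l, _, Z').
      (\<forall>i\<in>{1,2,3,4,5}. Z' i = ?Z i) \<and> l = (if d dvd c then 2 else 11))"
      by (rule K_multiples[where m = 0]) (use less.prems lt in auto)
    show ?thesis
      apply (rule leads_step, rule leads_step, rule leads_step)
      apply (rule leads_trans[where P = "\<lambda>(l, _, Z').
      (\<forall>i\<in>{1,2,3,4,5}. Z' i = ?Z i) \<and> l = (if d dvd c then 2 else 11)"])
      subgoal using less.prems lt l by (simp add: machine_K_nth)
    proof -
      fix c' :: config
      assume "case c' of (l, _, Z') \<Rightarrow>
        (\<forall>i\<in>{1,2,3,4,5}. Z' i = ?Z i) \<and> l = (if d dvd c then 2 else 11)"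
      then obtain l I' Z' where c': "c' = (l, I', Z')" "l = (if d dvd c then 2 else 11)"
        "Z' 1 = Z 1" "Z' 2 = Z 2" "Z' 3 = Z 3" "Z' 4 = Z 4" "Z' 5 = Z 5"
        by (cases c') auto
      show "K_leads c' (\<lambda>(l, _, Z').
        (\<forall>i\<in>{1,2,3,4}. Z' i = Z i) \<and> l = (if prime c then 13 else 2))"
      proof (cases "d dvd c")
        case True
        then have "\<not> prime c"
          using lt less.prems(4) unfolding prime_nat_iff by auto
        then show ?thesis
          using True c' by (intro leads_now) simp
      next
        case False
        let ?Z2 = "Z'(5 := real (Suc d))"
        have "K_leads (4, I', ?Z2) (\<lambda>(l, _, Z').
          (\<forall>i\<in>{1,2,3,4}. Z' i = ?Z2 i) \<and> l = (if prime c then 13 else 2))"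
          by (rule less.hyps[of "Suc d"])
            (use less.prems lt c' False in \<open>auto simp: less_Suc_eq\<close>)
        then show ?thesis
          apply -
          apply (rule leads_step, rule leads_step)
          using False c' less.prems by (simp add: machine_K_nth algebra_simps)
      qed
    qed
  qed
qed

text \<open>The run is followed past the decrement of register 1 to the test at label 14, which
  every found prime reaches; this label is the recurring point for counting primes.\<close>

lemma K_next_prime:
  assumes "Z 3 = 1" "Z 4 = real c" "c \<ge> 1" "c < q" "prime q" "\<forall>e. c < e \<and> e < q \<longrightarrow> \<not> prime e"
  shows "K_leads (2, I, Z) (\<lambda>(l, _, Z').
    Z' 1 = Z 1 - 1 \<and> Z' 2 = Z 2 \<and> Z' 3 = 1 \<and> Z' 4 = real q \<and> l = 14)"
  using assms
proof (induction "q - c" arbitrary: Z I c rule: less_induct)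
  case less
  let ?Z = "Z(4 := real (Suc c), 5 := 2)"
  let ?P = "\<lambda>(l, _, Z'). (\<forall>i\<in>{1,2,3,4}. Z' i = ?Z i) \<and> l = (if prime (Suc c) then 13 else 2)"
  have l: "K_leads (4, I, ?Z) ?P"
    by (rule K_trial_division[where d = 2]) (use less.prems in auto)
  show ?case
    apply (rule leads_step, rule leads_step)
    apply (rule leads_trans[where P = ?P])
    subgoal using less.prems l by (simp add: machine_K_nth algebra_simps)
  proof -
    fix c' :: config
    assume "?P c'"
    then obtain l I' Z' where c': "c' = (l, I', Z')" "l = (if prime (Suc c) then 13 else 2)"
      "Z' 1 = Z 1" "Z' 2 = Z 2" "Z' 3 = Z 3" "Z' 4 = real (Suc c)"
      by (cases c') auto
    show "K_leads c' (\<lambda>(l, _, Z').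
      Z' 1 = Z 1 - 1 \<and> Z' 2 = Z 2 \<and> Z' 3 = 1 \<and> Z' 4 = real q \<and> l = 14)"
    proof (cases "prime (Suc c)")
      case True
      then have "q = Suc c"
        using less.prems by (metis Suc_lessI lessI)
      then show ?thesis
        using True c' less.prems
        apply -
        apply (rule leads_step, rule leads_now)
        by (simp add: machine_K_nth)
    next
      case False
      then have "Suc c \<noteq> q" using less.prems by auto
      have "K_leads (2, I', Z') (\<lambda>(l, _, Z'').
        Z'' 1 = Z' 1 - 1 \<and> Z'' 2 = Z' 2 \<and> Z'' 3 = 1 \<and> Z'' 4 = real q \<and> l = 14)"
        by (rule less.hyps[of "Suc c"])
          (use less.prems c' \<open>Suc c \<noteq> q\<close> in auto)
      then show ?thesis
        using c' False by simp
    qed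
  qed
qed

text \<open>Stopping is permanent, so a prefix of the run may be discarded before the invariant is
  established.\<close>

lemma not_leads_stopped_if_leads:
  assumes "leads Q p c Inv"
    and not_stopped: "\<And>c. Inv c \<Longrightarrow> \<not> stopped p c"
    and progress: "\<And>c. Inv c \<Longrightarrow> leads Q p (step Q p c) Inv"
  shows "\<not> leads Q p c (stopped p)"
proof
  assume "leads Q p c (stopped p)"
  then obtain n where n: "stopped p ((step Q p ^^ n) c)"
    by (auto simp: leads_def)
  obtain k where k: "Inv ((step Q p ^^ k) c)"
    using assms(1) unfolding leads_def by blast
  have "stopped p ((step Q p ^^ n) ((step Q p ^^ k) c))"
    using n stopped_funpow[OF n] by (metis comp_apply funpow_add add.commute)
  moreover have "\<not> leads Q p ((step Q p ^^ k) c) (stopped p)"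
    using k not_stopped progress by (rule not_leads_stopped)
  ultimately show False
    by (auto simp: leads_def)
qed

text \<open>\<open>enumerate\<close> counts from 0, so \<open>Suc m\<close> primes have been found
  here, and the test at label 14 succeeds iff \<open>a = real (Suc m)\<close>.\<close>

definition K_counted :: "real \<Rightarrow> real \<Rightarrow> nat \<Rightarrow> config \<Rightarrow> bool" where
  "K_counted a x m = (\<lambda>(l, _, Z). l = 14 \<and> Z 1 = a - real (Suc m) \<and> Z 2 = x \<and> Z 3 = 1
     \<and> Z 4 = real (enumerate {p. prime p} m))"

lemma infinite_primes_nat: "infinite {p::nat. prime p}"
  using primes_infinite by blast

lemma prime_enumerate: "prime (enumerate {p::nat. prime p} m)"
  using enumerate_in_set[OF infinite_primes_nat] by blast

lemma K_counted_0: "K_leads (init [a, x]) (K_counted a x 0)"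
proof -
  let ?Z = "(load [a, x])(3 := 1, 4 := real 1)"
  have two: "enumerate {p::nat. prime p} 0 = 2"
    unfolding enumerate_0
    by (rule Least_equality) (auto simp: two_is_prime_nat dest: prime_ge_2_nat)
  have "K_leads (2, \<lambda>_. 2, ?Z) (\<lambda>(l, _, Z').
      Z' 1 = ?Z 1 - 1 \<and> Z' 2 = ?Z 2 \<and> Z' 3 = 1 \<and> Z' 4 = real 2 \<and> l = 14)"
    by (rule K_next_prime[where c = 1]) auto
  then have "K_leads (2, \<lambda>_. 2, ?Z) (K_counted a x 0)"
    by (rule leads_trans) (auto simp: K_counted_def load_def two intro: leads_now)
  then show ?thesis
    apply -
    apply (rule leads_step, rule leads_step)
    by (simp add: init_def machine_K_nth numeral_2_eq_2)
qed

lemma K_counted_Suc: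
  assumes "K_counted a x m c" "a \<noteq> real (Suc m)"
  shows "K_leads (step {} machine_K c) (K_counted a x (Suc m))"
proof -
  obtain I Z where c: "c = (14, I, Z)" and Z: "Z 1 = a - real (Suc m)" "Z 2 = x" "Z 3 = 1"
    "Z 4 = real (enumerate {p. prime p} m)"
    using assms(1) by (cases c) (auto simp: K_counted_def)
  let ?p = "enumerate {p::nat. prime p} m" and ?q = "enumerate {p::nat. prime p} (Suc m)"
  have pq: "?p < ?q"
    using enumerate_step[OF infinite_primes_nat] .
  have "prime ?p" "prime ?q"
    by (rule prime_enumerate)+
  moreover have "\<not> prime e" if "?p < e" "e < ?q" for e
    using that not_less_Least[of e "\<lambda>s. s \<in> {p. prime p} \<and> ?p < s"]
    unfolding enumerate_Suc''[OF infinite_primes_nat] by auto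
  ultimately have "K_leads (2, I, Z) (\<lambda>(l, _, Z').
      Z' 1 = Z 1 - 1 \<and> Z' 2 = Z 2 \<and> Z' 3 = 1 \<and> Z' 4 = real ?q \<and> l = 14)"
    using Z pq prime_gt_0_nat[of ?p] by (intro K_next_prime[where c = ?p]) auto
  then have "K_leads (2, I, Z) (K_counted a x (Suc m))"
    by (rule leads_trans) (use Z in \<open>auto simp: K_counted_def intro!: leads_now\<close>)
  then show ?thesis
    using assms(2) c Z by (simp add: machine_K_nth)
qed

text \<open>The counter takes only the values \<open>a - 1\<close>, \<open>a - 2\<close>, and so on;
  unless \<open>a\<close> is a positive integer it misses 0 and the search for primes never ends.
  This lets membership in \<open>H1_add\<close> certify the index.\<close>

lemma K_not_halts_if_not_index:
  assumes "\<And>j. j \<ge> 1 \<Longrightarrow> a \<noteq> real j"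
  shows "\<not> halts_on machine_K [a, x]"
proof -
  let ?Inv = "\<lambda>c. \<exists>m. K_counted a x m c"
  have "\<not> K_leads (init [a, x]) (stopped machine_K)"
  proof (rule not_leads_stopped_if_leads[where Inv = ?Inv])
    show "K_leads (init [a, x]) ?Inv"
      using K_counted_0 by (rule leads_trans) (auto intro: leads_now)
  next
    fix c assume "?Inv c"
    then show "\<not> stopped machine_K c"
      by (auto simp: K_counted_def stopped_def machine_K_nth)
  next
    fix c assume "?Inv c"
    then obtain m where "K_counted a x m c" by blast
    then have "K_leads (step {} machine_K c) (K_counted a x (Suc m))"
      using assms[of "Suc m"] by (intro K_counted_Suc) auto
    then show "K_leads (step {} machine_K c) ?Inv"
      by (rule leads_trans) (auto intro: leads_now)
  qed
  then show ?thesis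
    by (simp add: halts_on_iff_leads)
qed

section \<open>Enumeration of fractions and the halting set of the machine\<close>

definition K_pair :: "nat \<Rightarrow> real \<Rightarrow> nat \<Rightarrow> nat \<Rightarrow> config \<Rightarrow> bool" where
  "K_pair p x r q = (\<lambda>(l, _, Z). l = 17 \<and> Z 2 = x \<and> Z 3 = 1 \<and> Z 4 = real p
     \<and> Z 8 = real r \<and> Z 9 = real q)"

lemma K_first_pair:
  assumes "j \<ge> 1"
  shows "K_leads (init [real j, x]) (K_pair (nth_prime j) x 0 1)"
proof -
  have "K_leads (init [real j, x]) (K_counted (real j) x m)" if "m < j" for m
    using that
  proof (induction m)
    case 0
    show ?case by (rule K_counted_0)
  next
    case (Suc m)
    show ?case
      by (rule leads_trans[OF Suc.IH])
        (use Suc.prems in \<open>auto intro!: leads_step[OF K_counted_Suc]\<close>)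
  qed
  from this[of "j - 1"] assms
  have "K_leads (init [real j, x]) (K_counted (real j) x (j - 1))" by simp
  then show ?thesis
  proof (rule leads_trans)
    fix c assume "K_counted (real j) x (j - 1) c"
    then obtain I Z where "c = (14, I, Z)" "Z 1 = 0" "Z 2 = x" "Z 3 = 1"
      "Z 4 = real (nth_prime j)"
      using assms by (cases c) (auto simp: K_counted_def nth_prime_def)
    then show "K_leads c (K_pair (nth_prime j) x 0 1)"
      apply -
      apply (rule leads_step, rule leads_step, rule leads_step, rule leads_now)
      by (simp add: machine_K_nth K_pair_def)
  qed
qed

text \<open>Both products are built by repeated addition with the test after the body, hence
  \<open>k < q\<close>; \<open>K_loop_r\<close> tests first because \<open>r\<close> may be
  0.\<close>

lemma K_loop_q:
  assumes "Z 2 = x" "Z 3 = 1" "Z 9 = real q" "Z 10 = real k" "k < q"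
    "Z 11 = real k * x" "Z 12 = real k * real q"
  shows "K_leads (20, I, Z) (\<lambda>(l, _, Z'). l = 25 \<and> (\<forall>i\<in>{2,3,4,8,9}. Z' i = Z i)
    \<and> Z' 11 = real q * x \<and> Z' 12 = real q * real q)"
  using assms
proof (induction "q - k" arbitrary: Z I k rule: less_induct)
  case less
  let ?Z = "Z(11 := real (Suc k) * x, 12 := real (Suc k) * real q, 10 := real (Suc k),
    7 := real q - real (Suc k))"
  have s: "step {} machine_K (step {} machine_K (step {} machine_K (step {} machine_K (20, I, Z))))
    = (24, I, ?Z)"
    using less.prems by (simp add: machine_K_nth fun_eq_iff algebra_simps)
  show ?case
  proof (cases "Suc k = q")
    case True
    show ?thesis
      apply (rule leads_step, rule leads_step, rule leads_step, rule leads_step, subst s)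
      apply (rule leads_step, rule leads_now)
      using True by (auto simp: machine_K_nth)
  next
    case False
    have "K_leads (20, I, ?Z) (\<lambda>(l, _, Z'). l = 25 \<and> (\<forall>i\<in>{2,3,4,8,9}. Z' i = ?Z i)
      \<and> Z' 11 = real q * x \<and> Z' 12 = real q * real q)"
      by (rule less.hyps[of "Suc k"]) (use less.prems False in auto)
    then show ?thesis
      apply -
      apply (rule leads_step, rule leads_step, rule leads_step, rule leads_step, subst s)
      apply (rule leads_step)
      using False by (simp add: machine_K_nth)
  qed
qed

lemma K_loop_r:
  assumes "Z 3 = 1" "Z 8 = real r" "Z 10 = real k" "k \<le> r" "Z 13 = real k * real r"
  shows "K_leads (27, I, Z) (\<lambda>(l, _, Z'). l = 32 \<and> (\<forall>i\<in>{2,3,4,8,9,11,12}. Z' i = Z i)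
    \<and> Z' 13 = real r * real r)"
  using assms
proof (induction "r - k" arbitrary: Z I k rule: less_induct)
  case less
  show ?case
  proof (cases "k = r")
    case True
    show ?thesis
      apply (rule leads_step, rule leads_step, rule leads_now)
      using True less.prems by (auto simp: machine_K_nth)
  next
    case False
    let ?Z = "Z(7 := real r - real k, 13 := real (Suc k) * real r, 10 := real (Suc k))"
    have s: "step {} machine_K (step {} machine_K (step {} machine_K (step {} machine_K
      (step {} machine_K (27, I, Z))))) = (27, I, ?Z)"
      using less.prems False by (simp add: machine_K_nth fun_eq_iff algebra_simps)
    have "K_leads (27, I, ?Z) (\<lambda>(l, _, Z'). l = 32 \<and> (\<forall>i\<in>{2,3,4,8,9,11,12}. Z' i = ?Z i)
      \<and> Z' 13 = real r * real r)"
      by (rule less.hyps[of "Suc k"]) (use less.prems False in auto)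
    then show ?thesis
      apply -
      apply (rule leads_step, rule leads_step, rule leads_step, rule leads_step, rule leads_step,
        subst s)
      by simp
  qed
qed

lemma K_loop_p:
  assumes "Z 3 = 1" "Z 4 = real p" "Z 10 = real k" "k < p" "Z 14 = real k * Z 12"
  shows "K_leads (34, I, Z) (\<lambda>(l, _, Z'). l = 38 \<and> (\<forall>i\<in>{2,3,4,8,9,11,12,13}. Z' i = Z i)
    \<and> Z' 7 = 0 \<and> Z' 14 = real p * Z 12)"
  using assms
proof (induction "p - k" arbitrary: Z I k rule: less_induct)
  case less
  let ?Z = "Z(14 := real (Suc k) * Z 12, 10 := real (Suc k), 7 := real p - real (Suc k))"
  have s: "step {} machine_K (step {} machine_K (step {} machine_K (34, I, Z))) = (37, I, ?Z)"
    using less.prems by (simp add: machine_K_nth fun_eq_iff algebra_simps)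
  show ?case
  proof (cases "Suc k = p")
    case True
    show ?thesis
      apply (rule leads_step, rule leads_step, rule leads_step, subst s)
      apply (rule leads_step, rule leads_now)
      using True by (auto simp: machine_K_nth)
  next
    case False
    have "K_leads (34, I, ?Z) (\<lambda>(l, _, Z'). l = 38 \<and> (\<forall>i\<in>{2,3,4,8,9,11,12,13}. Z' i = ?Z i)
      \<and> Z' 7 = 0 \<and> Z' 14 = real p * ?Z 12)"
      by (rule less.hyps[of "Suc k"]) (use less.prems False in auto)
    then show ?thesis
      apply -
      apply (rule leads_step, rule leads_step, rule leads_step, subst s)
      apply (rule leads_step)
      using False by (simp add: machine_K_nth)
  qed
qed

definition K_test :: "nat \<Rightarrow> real \<Rightarrow> nat \<Rightarrow> nat \<Rightarrow> config \<Rightarrow> bool" where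
  "K_test p x r q = (\<lambda>(l, _, Z). l = 40 \<and> Z 2 = x \<and> Z 3 = 1 \<and> Z 4 = real p \<and> Z 7 = 0
     \<and> Z 8 = real r \<and> Z 9 = real q \<and> Z 11 = real r - real q * x
     \<and> Z 14 = real p * (real q * real q) - real r * real r)"

lemma K_pair_test:
  assumes "K_pair p x r q c" "p \<ge> 1" "q \<ge> 1"
  shows "K_leads (step {} machine_K c) (K_test p x r q)"
proof -
  obtain I Z where c: "c = (17, I, Z)" and Z: "Z 2 = x" "Z 3 = 1" "Z 4 = real p"
    "Z 8 = real r" "Z 9 = real q"
    using assms(1) by (cases c) (auto simp: K_pair_def)
  let ?Z = "Z(10 := 0, 11 := 0, 12 := 0)"
  let ?P = "\<lambda>(l, _, Z'). l = 25 \<and> (\<forall>i\<in>{2,3,4,8,9}. Z' i = ?Z i)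
    \<and> Z' 11 = real q * x \<and> Z' 12 = real q * real q"
  have "K_leads (20, I, ?Z) ?P"
    by (rule K_loop_q[where k = 0]) (use Z assms in auto)
  then have "K_leads (20, I, ?Z) (K_test p x r q)"
  proof (rule leads_trans)
    fix c1 :: config assume "?P c1"
    then obtain I1 Z1 where c1: "c1 = (25, I1, Z1)" and Z1: "Z1 2 = x" "Z1 3 = 1" "Z1 4 = real p"
      "Z1 8 = real r" "Z1 9 = real q" "Z1 11 = real q * x" "Z1 12 = real q * real q"
      using Z by (cases c1) auto
    let ?Z1 = "Z1(10 := 0, 13 := 0)"
    let ?P1 = "\<lambda>(l, _, Z'). l = 32 \<and> (\<forall>i\<in>{2,3,4,8,9,11,12}. Z' i = ?Z1 i)
      \<and> Z' 13 = real r * real r"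
    have "K_leads (27, I1, ?Z1) ?P1"
      by (rule K_loop_r[where k = 0]) (use Z1 in auto)
    then have "K_leads (27, I1, ?Z1) (K_test p x r q)"
    proof (rule leads_trans)
      fix c2 :: config assume "?P1 c2"
      then obtain I2 Z2 where c2: "c2 = (32, I2, Z2)" and Z2: "Z2 2 = x" "Z2 3 = 1"
        "Z2 4 = real p" "Z2 8 = real r" "Z2 9 = real q" "Z2 11 = real q * x"
        "Z2 12 = real q * real q" "Z2 13 = real r * real r"
        using Z1 by (cases c2) auto
      let ?Z2 = "Z2(10 := 0, 14 := 0)"
      let ?P2 = "\<lambda>(l, _, Z'). l = 38 \<and> (\<forall>i\<in>{2,3,4,8,9,11,12,13}. Z' i = ?Z2 i)
        \<and> Z' 7 = 0 \<and> Z' 14 = real p * ?Z2 12"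
      have "K_leads (34, I2, ?Z2) ?P2"
        by (rule K_loop_p[where k = 0]) (use Z2 assms in auto)
      then have "K_leads (34, I2, ?Z2) (K_test p x r q)"
      proof (rule leads_trans)
        fix c3 :: config assume "?P2 c3"
        then obtain I3 Z3 where c3: "c3 = (38, I3, Z3)" and Z3: "Z3 2 = x" "Z3 3 = 1"
          "Z3 4 = real p" "Z3 8 = real r" "Z3 9 = real q" "Z3 11 = real q * x" "Z3 7 = 0"
          "Z3 13 = real r * real r" "Z3 14 = real p * (real q * real q)"
          using Z2 by (cases c3) auto
        show "K_leads c3 (K_test p x r q)"
          unfolding c3
          apply (rule leads_step, rule leads_step, rule leads_now)
          using Z3 by (simp add: machine_K_nth K_test_def)
      qed
      then show "K_leads c2 (K_test p x r q)"
        unfolding c2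
        apply -
        apply (rule leads_step, rule leads_step)
        by (simp add: machine_K_nth)
    qed
    then show "K_leads c1 (K_test p x r q)"
      unfolding c1
      apply -
      apply (rule leads_step, rule leads_step)
      by (simp add: machine_K_nth)
  qed
  then show ?thesis
    unfolding c
    apply -
    apply (rule leads_step, rule leads_step)
    by (simp add: machine_K_nth)
qed

text \<open>The inequalities between \<open>x\<close>, \<open>r/q\<close> and the root of
  \<open>p\<close>, cleared of denominators and roots, as the machine evaluates them;
  \<open>separates_iff\<close> returns to the fractions.\<close>

definition separates :: "nat \<Rightarrow> real \<Rightarrow> nat \<Rightarrow> nat \<Rightarrow> bool" where
  "separates p x r q \<longleftrightarrow>
     (real q * x < real r \<and> real r * real r < real p * (real q * real q)) \<or>
     (real q * x > real r \<and> real r * real r > real p * (real q * real q))"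

lemma K_pair_stops:
  assumes "K_pair p x r q c" "p \<ge> 1" "q \<ge> 1" "separates p x r q"
  shows "K_leads c (stopped machine_K)"
proof (rule leads_step, rule leads_trans[OF K_pair_test[OF assms(1-3)]])
  fix c :: config assume "K_test p x r q c"
  then obtain I Z where c: "c = (40, I, Z)" and Z: "Z 11 = real r - real q * x"
    "Z 14 = real p * (real q * real q) - real r * real r"
    by (cases c) (auto simp: K_test_def)
  show "K_leads c (stopped machine_K)"
    unfolding c
    apply (rule leads_step, rule leads_step, rule leads_step, rule leads_step, rule leads_now)
    using Z assms(4) by (auto simp: machine_K_nth stopped_def separates_def)
qed

fun next_pair :: "nat \<times> nat \<Rightarrow> nat \<times> nat" where
  "next_pair (r, q) = (if r = 0 then (q, 1) else (r - 1, Suc q))"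

lemma K_pair_next:
  assumes "K_pair p x r q c" "p \<ge> 1" "q \<ge> 1" "\<not> separates p x r q" "next_pair (r, q) = (r', q')"
  shows "K_leads (step {} machine_K c) (K_pair p x r' q')"
proof (rule leads_trans[OF K_pair_test[OF assms(1-3)]])
  fix c :: config assume "K_test p x r q c"
  then obtain I Z where c: "c = (40, I, Z)" and Z: "Z 2 = x" "Z 3 = 1" "Z 4 = real p" "Z 7 = 0"
    "Z 8 = real r" "Z 9 = real q" "Z 11 = real r - real q * x"
    "Z 14 = real p * (real q * real q) - real r * real r"
    by (cases c) (auto simp: K_test_def)
  have 45: "K_leads (45, I, Z) (K_pair p x r' q')"
  proof (cases "r = 0")
    case True
    then show ?thesis
      apply -
      apply (rule leads_step, rule leads_step, rule leads_step, rule leads_step, rule leads_now)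
      using Z assms(5) by (auto simp: machine_K_nth K_pair_def)
  next
    case False
    then show ?thesis
      apply -
      apply (rule leads_step, rule leads_step, rule leads_step, rule leads_step, rule leads_now)
      using Z assms(5) by (auto simp: machine_K_nth K_pair_def)
  qed
  show "K_leads c (K_pair p x r' q')"
  proof (cases "Z 11 = 0 \<or> Z 14 = 0")
    case True
    show ?thesis
    proof (cases "Z 11 = 0")
      case True
      then show ?thesis
        unfolding c using 45 by (intro leads_step[of _ _ "(40, I, Z)"]) (simp add: machine_K_nth)
    next
      case False
      then show ?thesis
        unfolding c using 45 \<open>Z 11 = 0 \<or> Z 14 = 0\<close>
        apply -
        apply (rule leads_step, rule leads_step)
        by (simp add: machine_K_nth)
    qed
  next
    case False
    \<comment> \<open>Both differences are nonzero, and equal signs would mean separation; opposite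
      signs lead back to label 45.\<close>
    then have "(Z 11 > 0 \<and> Z 14 < 0) \<or> (Z 11 < 0 \<and> Z 14 > 0)"
      using assms(4) unfolding Z(7,8) separates_def by linarith
    then show ?thesis
      unfolding c
      apply -
      apply (rule leads_step, rule leads_step, rule leads_step, rule leads_step)
      apply (erule disjE)
      using 45 by (simp_all add: machine_K_nth)
  qed
qed

text \<open>Each antidiagonal is finite and is walked completely, so every pair has only finitely
  many predecessors; the alternative is that an earlier pair separates and stops the run.\<close>

lemma K_reaches_pair:
  assumes "K_pair p x 0 1 c" "p \<ge> 1" "q \<ge> 1"
  shows "K_leads c (stopped machine_K) \<or> K_leads c (K_pair p x r q)"
proof -
  have advance: "K_leads c (stopped machine_K) \<or> K_leads c (K_pair p x r' q')"
    if "K_leads c (stopped machine_K) \<or> K_leads c (K_pair p x r q)" "q \<ge> 1"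
      "next_pair (r, q) = (r', q')" for r q r' q'
    using that(1)
  proof
    assume r: "K_leads c (K_pair p x r q)"
    show ?thesis
    proof (cases "separates p x r q")
      case True
      have "K_leads c (stopped machine_K)"
        by (rule leads_trans[OF r]) (rule K_pair_stops[OF _ assms(2) that(2) True])
      then show ?thesis ..
    next
      case False
      have "K_leads c (K_pair p x r' q')"
        by (rule leads_trans[OF r])
          (rule leads_step, rule K_pair_next[OF _ assms(2) that(2) False that(3)])
      then show ?thesis ..
    qed
  qed simp
  \<comment> \<open>The pair lies on the antidiagonal \<open>r + q = Suc s\<close>. The outer
    induction moves between antidiagonals, the inner one along a single one.\<close>
  have "K_leads c (stopped machine_K) \<or> K_leads c (K_pair p x (s - i) (Suc i))" if "i \<le> s" for s i
    using that
  proof (induction s arbitrary: i)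
    case 0
    then show ?case
      using assms(1) by (auto intro: leads_now)
  next
    case (Suc s)
    from Suc.prems show ?case
    proof (induction i)
      case 0
      \<comment> \<open>The last pair \<open>(0, Suc s)\<close> of one antidiagonal is followed by
        the first pair \<open>(Suc s, 1)\<close> of the next.\<close>
      have "K_leads c (stopped machine_K) \<or> K_leads c (K_pair p x (s - s) (Suc s))"
        by (rule Suc.IH) simp
      then show ?case
        using advance[of 0 "Suc s" "Suc s" 1] by simp
    next
      case (Suc i)
      then have "K_leads c (stopped machine_K) \<or> K_leads c (K_pair p x (Suc s - i) (Suc i))"
        by simp
      then show ?case
        using advance[of "Suc s - i" "Suc i" "Suc s - Suc i" "Suc (Suc i)"] Suc.prems by simp
    qed
  qed
  from this[of "q - 1" "r + q - 1"] assms(3) show ?thesis by simp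
qed

lemma separates_iff:
  assumes "q \<ge> 1"
  shows "separates p x r q \<longleftrightarrow>
    (x < real r / real q \<and> real r / real q < sqrt (real p)) \<or>
    (x > real r / real q \<and> real r / real q > sqrt (real p))"
proof -
  have q: "real q > 0" using assms by simp
  have "real q * x < real r \<longleftrightarrow> x < real r / real q" "real q * x > real r \<longleftrightarrow> x > real r / real q"
    using q by (simp_all add: field_simps)
  moreover have "real r / real q < sqrt (real p) \<longleftrightarrow> real r * real r < real p * (real q * real q)"
  proof -
    have "real r / real q < sqrt (real p) \<longleftrightarrow> sqrt ((real r / real q)\<^sup>2) < sqrt (real p)"
      by simp
    also have "\<dots> \<longleftrightarrow> real r * real r < real p * (real q * real q)"
      using q by (simp only: real_sqrt_less_iff) (simp add: field_simps power2_eq_square)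
    finally show ?thesis .
  qed
  moreover have "real r / real q > sqrt (real p) \<longleftrightarrow> real r * real r > real p * (real q * real q)"
  proof -
    have "real r / real q > sqrt (real p) \<longleftrightarrow> sqrt ((real r / real q)\<^sup>2) > sqrt (real p)"
      by simp
    also have "\<dots> \<longleftrightarrow> real r * real r > real p * (real q * real q)"
      using q by (simp only: real_sqrt_less_iff) (simp add: field_simps power2_eq_square)
    finally show ?thesis .
  qed
  ultimately show ?thesis
    by (simp add: separates_def)
qed

lemma ex_nat_quotient_between:
  fixes u v :: real
  assumes "0 \<le> u" "u < v"
  obtains r q :: nat where "q \<ge> 1" "u < real r / real q" "real r / real q < v"
proof -
  obtain s where s: "u < of_rat s" "of_rat s < v"
    using of_rat_dense[OF assms(2)] by blast
  obtain a b where ab: "quotient_of s = (a, b)" by fastforce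
  have b: "b > 0" using quotient_of_denom_pos[OF ab] .
  have s_eq: "(of_rat s :: real) = of_int a / of_int b"
    using quotient_of_div[OF ab] by (simp add: of_rat_divide)
  have "of_int a / (of_int b :: real) > 0"
    using s(1) assms(1) s_eq by linarith
  then have "a > 0" using b by (simp add: zero_less_divide_iff)
  then have "of_rat s = real (nat a) / real (nat b)" "nat b \<ge> 1"
    using b s_eq by simp_all
  then show ?thesis
    using that[of "nat b" "nat a"] s by metis
qed

text \<open>If \<open>x\<close> differs from the root, some fraction lies strictly between
  \<open>x\<close> or 0 and the root, and the machine meets it unless it stops earlier; if they
  agree, no fraction separates them.\<close>

lemma K_halts_iff:
  assumes "j \<ge> 1"
  shows "halts_on machine_K [real j, x] \<longleftrightarrow> x \<noteq> sqrt (real (nth_prime j))"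
proof -
  let ?p = "nth_prime j"
  have p: "?p \<ge> 1"
    using prime_gt_0_nat[OF prime_enumerate[of "j - 1"]] by (simp add: nth_prime_def)
  show ?thesis
  proof
    assume ne: "x \<noteq> sqrt (real ?p)"
    obtain r q where q: "q \<ge> 1" and sep: "separates ?p x r q"
    proof (cases "x < sqrt (real ?p)")
      case True
      \<comment> \<open>Fractions of naturals are nonnegative, so a negative \<open>x\<close> is
        replaced by 0.\<close>
      then have "max 0 x < sqrt (real ?p)" using p by simp
      then obtain r q where "q \<ge> 1" "max 0 x < real r / real q" "real r / real q < sqrt (real ?p)"
        by (rule ex_nat_quotient_between[OF max.cobounded1])
      then show ?thesis
        using that[of q r] separates_iff[of q ?p x r] by simp
    next
      case False
      then have "sqrt (real ?p) < x" using ne by simp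
      then obtain r q where "q \<ge> 1" "sqrt (real ?p) < real r / real q" "real r / real q < x"
        by (rule ex_nat_quotient_between[OF real_sqrt_ge_zero[OF of_nat_0_le_iff]])
      then show ?thesis
        using that[of q r] separates_iff[of q ?p x r] by simp
    qed
    have "K_leads (init [real j, x]) (stopped machine_K)"
    proof (rule leads_trans[OF K_first_pair[OF assms]])
      fix c assume c: "K_pair ?p x 0 1 c"
      show "K_leads c (stopped machine_K)"
        using K_reaches_pair[OF c p q, of r]
      proof
        assume "K_leads c (K_pair ?p x r q)"
        then show ?thesis
          by (rule leads_trans) (rule K_pair_stops[OF _ p q sep])
      qed
    qed
    then show "halts_on machine_K [real j, x]"
      by (simp add: halts_on_iff_leads)
  next
    assume halts: "halts_on machine_K [real j, x]"
    show "x \<noteq> sqrt (real ?p)"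
    proof
      assume x: "x = sqrt (real ?p)"
      let ?Inv = "\<lambda>c. \<exists>r q. q \<ge> 1 \<and> K_pair ?p x r q c"
      have no: "\<not> separates ?p x r q" if "q \<ge> 1" for r q
        using separates_iff[OF that, of ?p x r] x by auto
      have "\<not> K_leads (init [real j, x]) (stopped machine_K)"
      proof (rule not_leads_stopped_if_leads[where Inv = ?Inv])
        show "K_leads (init [real j, x]) ?Inv"
          using K_first_pair[OF assms] by (rule leads_trans) (auto intro: leads_now)
      next
        fix c assume "?Inv c"
        then show "\<not> stopped machine_K c"
          by (auto simp: K_pair_def stopped_def machine_K_nth)
      next
        fix c assume "?Inv c"
        then obtain r q where c: "q \<ge> 1" "K_pair ?p x r q c" by blast
        obtain r' q' where n: "next_pair (r, q) = (r', q')" by fastforce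
        then have "q' \<ge> 1" by (cases "r = 0") auto
        have "K_leads (step {} machine_K c) (K_pair ?p x r' q')"
          by (rule K_pair_next[OF c(2) p c(1) no[OF c(1)] n])
        then show "K_leads (step {} machine_K c) ?Inv"
          by (rule leads_trans) (use \<open>q' \<ge> 1\<close> in \<open>auto intro: leads_now\<close>)
      qed
      then show False
        using halts by (simp add: halts_on_iff_leads)
    qed
  qed
qed

section \<open>Lower bounds\<close>

text \<open>Componentwise sum and difference of coefficient pairs mirror \<open>Add\<close> and
  \<open>Sub\<close>, so register contents can be tracked independently of \<open>x\<close>.\<close>

definition ev :: "real \<Rightarrow> int \<times> int \<Rightarrow> real" where
  "ev x f = of_int (fst f) + of_int (snd f) * x"

lemma ev_simps [simp]:
  "ev x (0, 0) = 0" "ev x (0, 1) = x" "ev x (a, 0) = of_int a"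
  "ev x (f + g) = ev x f + ev x g" "ev x (f - g) = ev x f - ev x g"
  by (simp_all add: ev_def algebra_simps)

text \<open>1 and an irrational \<open>x\<close> are linearly independent over the rationals, so
  equality with an integer is a condition on the coefficients alone.\<close>

lemma ev_eq_int_iff:
  assumes "x \<notin> \<rat>"
  shows "ev x f = of_int n \<longleftrightarrow> f = (n, 0)"
proof
  assume *: "ev x f = of_int n"
  have "snd f = 0"
  proof (rule ccontr)
    assume "snd f \<noteq> 0"
    then have "x = of_int (n - fst f) / of_int (snd f)"
      using * by (simp add: ev_def field_simps)
    then show False
      using assms by (metis Rats_divide Rats_of_int)
  qed
  then show "f = (n, 0)"
    using * by (simp add: ev_def prod_eq_iff)
qed simp

lemma ev_eq_0_iff: "x \<notin> \<rat> \<Longrightarrow> ev x f = 0 \<longleftrightarrow> f = (0, 0)"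
  using ev_eq_int_iff[of x f 0] by simp

lemma load_map_ev:
  "load (map (ev x) fs) = (\<lambda>i. ev x (if 1 \<le> i \<and> i \<le> length fs then fs ! (i - 1) else (0, 0)))"
  by (auto simp: load_def fun_eq_iff)

lemma init_map_ev: "\<exists>I F. \<forall>x. init (map (ev x) fs) = (0, I, \<lambda>i. ev x (F i))"
  by (rule exI[of _ "\<lambda>_. length fs"],
      rule exI[of _ "\<lambda>i. if 1 \<le> i \<and> i \<le> length fs then fs ! (i - 1) else (0, 0)"])
    (simp add: init_def load_map_ev)

lemma contents_ev: "contents I (\<lambda>i. ev x (F i)) = map (ev x) (map F [1..<Suc (I 1)])"
  by (simp add: contents_def comp_def)

text \<open>All points of \<open>T\<close> are run in parallel with common label, index registers
  and coefficients. Order tests and oracle queries are assumed uniform on \<open>T\<close>; equality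
  tests are uniform by irrationality.\<close>

lemma step_ev:
  assumes "p \<in> M1_add_oracle" "l < length p" "\<And>x. x \<in> T \<Longrightarrow> x \<notin> \<rat>"
    and nonneg: "\<And>j l1 l2. p ! l = IfNonneg j l1 l2 \<Longrightarrow> \<exists>b. \<forall>x\<in>T. (0 \<le> ev x (F j)) = b"
    and query: "\<And>l1 l2. p ! l = IfOracle l1 l2 \<Longrightarrow>
      \<exists>b. \<forall>x\<in>T. (contents I (\<lambda>i. ev x (F i)) \<in> Q) = b"
  shows "\<exists>l' I' F'. l' < length p \<and>
    (\<forall>x\<in>T. step Q p (l, I, \<lambda>i. ev x (F i)) = (l', I', \<lambda>i. ev x (F' i)))"
proof -
  have "\<exists>l' I' F'. \<forall>x\<in>T. step Q p (l, I, \<lambda>i. ev x (F i)) = (l', I', \<lambda>i. ev x (F' i))"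
  proof (cases "p ! l")
    case (Add i j k)
    have "\<forall>x\<in>T. step Q p (l, I, \<lambda>i. ev x (F i)) = (Suc l, I, \<lambda>n. ev x ((F(i := F j + F k)) n))"
      using Add by (auto simp: fun_eq_iff)
    then show ?thesis by blast
  next
    case (Sub i j k)
    have "\<forall>x\<in>T. step Q p (l, I, \<lambda>i. ev x (F i)) = (Suc l, I, \<lambda>n. ev x ((F(i := F j - F k)) n))"
      using Sub by (auto simp: fun_eq_iff)
    then show ?thesis by blast
  next
    case (SetConst j c)
    then have "c \<in> {0, 1}"
      using assms(1,2) nth_mem[of l p] by (force simp: M1_add_oracle_def)
    \<comment> \<open>The constants 0 and 1 are integers, so the coefficients stay integral.\<close>
    then obtain d where "c = of_int d"
      by (metis empty_iff insert_iff of_int_0 of_int_1)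
    then have "\<forall>x\<in>T. step Q p (l, I, \<lambda>i. ev x (F i)) = (Suc l, I, \<lambda>n. ev x ((F(j := (d, 0))) n))"
      using SetConst by (auto simp: fun_eq_iff)
    then show ?thesis by blast
  next
    case (IfZero j l1 l2)
    have "\<forall>x\<in>T. step Q p (l, I, \<lambda>i. ev x (F i)) = (if F j = (0, 0) then l1 else l2, I, \<lambda>n. ev x (F n))"
      using IfZero assms(3) by (simp add: ev_eq_0_iff)
    then show ?thesis by blast
  next
    case (IfNonneg j l1 l2)
    obtain b where "\<forall>x\<in>T. (0 \<le> ev x (F j)) = b"
      using nonneg[OF IfNonneg] by (elim exE)
    then have "\<forall>x\<in>T. step Q p (l, I, \<lambda>i. ev x (F i)) = (if b then l1 else l2, I, \<lambda>n. ev x (F n))"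
      using IfNonneg by simp
    then show ?thesis by blast
  next
    case (Copy j k)
    have "\<forall>x\<in>T. step Q p (l, I, \<lambda>i. ev x (F i)) = (Suc l, I, \<lambda>n. ev x ((F(I j := F (I k))) n))"
      using Copy by (auto simp: fun_eq_iff)
    then show ?thesis by blast
  next
    case (IfOracle l1 l2)
    obtain b where "\<forall>x\<in>T. (contents I (\<lambda>i. ev x (F i)) \<in> Q) = b"
      using query[OF IfOracle] by (elim exE)
    then have "\<forall>x\<in>T. step Q p (l, I, \<lambda>i. ev x (F i)) = (if b then l1 else l2, I, \<lambda>n. ev x (F n))"
      using IfOracle by simp
    then show ?thesis by blast
  next
    case (IdxOne j)
    have "\<forall>x\<in>T. step Q p (l, I, \<lambda>i. ev x (F i)) = (Suc l, I(j := 1), \<lambda>n. ev x (F n))"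
      using IdxOne by simp
    then show ?thesis by blast
  next
    case (IdxInc j)
    have "\<forall>x\<in>T. step Q p (l, I, \<lambda>i. ev x (F i)) = (Suc l, I(j := I j + 1), \<lambda>n. ev x (F n))"
      using IdxInc by simp
    then show ?thesis by blast
  next
    case (IfIdxEq j k l1 l2)
    have "\<forall>x\<in>T. step Q p (l, I, \<lambda>i. ev x (F i)) = (if I j = I k then l1 else l2, I, \<lambda>n. ev x (F n))"
      using IfIdxEq by simp
    then show ?thesis by blast
  next
    case Stop
    have "\<forall>x\<in>T. step Q p (l, I, \<lambda>i. ev x (F i)) = (l, I, \<lambda>n. ev x (F n))"
      using Stop by simp
    then show ?thesis by blast
  qed
  then obtain l' I' F' where
    s: "\<forall>x\<in>T. step Q p (l, I, \<lambda>i. ev x (F i)) = (l', I', \<lambda>i. ev x (F' i))"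
    by blast
  show ?thesis
  proof (cases "T = {}")
    \<comment> \<open>For empty \<open>T\<close> the step equation says nothing about
      \<open>l'\<close>; the label \<open>l\<close> itself is within bounds.\<close>
    case True
    then show ?thesis using assms(2) by auto
  next
    case False
    have "wf_prog p" using assms(1) by (simp add: M1_add_oracle_def)
    then have "l' < length p"
      using False s wf_prog_step[OF _ assms(2), of Q I] by (metis ex_in_conv fst_conv)
    then show ?thesis using s by blast
  qed
qed

lemma M1_eq_add_run_ev:
  assumes "p \<in> M1_eq_add" "\<And>x. x \<in> T \<Longrightarrow> x \<notin> \<rat>"
  shows "\<exists>l I F. l < length p \<and>
    (\<forall>x\<in>T. (step Q p ^^ n) (init (map (ev x) fs)) = (l, I, \<lambda>i. ev x (F i)))"
proof (induction n)
  case 0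
  have "0 < length p"
    using assms(1) by (auto simp: M1_eq_add_def M1_add_def M1_add_oracle_def wf_prog_def)
  then show ?case
    using init_map_ev[of fs] by (metis funpow_0)
next
  case (Suc n)
  then obtain l I F where l: "l < length p"
    and s: "\<forall>x\<in>T. (step Q p ^^ n) (init (map (ev x) fs)) = (l, I, \<lambda>i. ev x (F i))"
    by blast
  have "p \<in> M1_add_oracle"
    using assms(1) by (simp add: M1_eq_add_def M1_add_def)
  moreover have "p ! l \<noteq> IfNonneg j l1 l2" "p ! l \<noteq> IfOracle l1 l2" for j l1 l2
    using assms(1) nth_mem[OF l] by (metis (mono_tags, lifting) M1_eq_add_def M1_add_def mem_Collect_eq)+
  ultimately have "\<exists>l' I' F'. l' < length p \<and>
    (\<forall>x\<in>T. step Q p (l, I, \<lambda>i. ev x (F i)) = (l', I', \<lambda>i. ev x (F' i)))"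
    using l assms(2) by (intro step_ev) auto
  then show ?case
    using s by simp
qed

text \<open>The runs at two irrational points proceed in lockstep, so they reach \<open>Stop\<close>
  after the same number of steps.\<close>

lemma M1_eq_add_halts_ev:
  assumes "p \<in> M1_eq_add" "x \<notin> \<rat>" "y \<notin> \<rat>" "halts_on p (map (ev x) fs)"
  shows "halts_on p (map (ev y) fs)"
proof -
  obtain n where n: "stopped p ((step {} p ^^ n) (init (map (ev x) fs)))"
    using assms(4) by (auto simp: halts_on_iff_leads leads_def)
  obtain l I F where
    "\<forall>z\<in>{x, y}. (step {} p ^^ n) (init (map (ev z) fs)) = (l, I, \<lambda>i. ev z (F i))"
    using M1_eq_add_run_ev[where T = "{x, y}" and Q = "{}", OF assms(1)] assms(2,3) by blast
  then have "stopped p ((step {} p ^^ n) (init (map (ev y) fs)))"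
    using n by (simp add: stopped_def)
  then show ?thesis
    by (auto simp: halts_on_iff_leads leads_def)
qed

lemma set_code: "set (code p) \<subseteq> {0, 1}"
  by (auto simp: code_def nat_code_def)

text \<open>A form with value 0 or 1 at an irrational point is constant, so program codes do not
  move with the evaluation point.\<close>

lemma map_ev_bits:
  assumes "x \<notin> \<rat>" "map (ev x) fs = cs" "set cs \<subseteq> {0, 1}"
  shows "map (ev y) fs = cs"
  unfolding assms(2)[symmetric]
proof (rule map_cong[OF refl])
  fix f assume "f \<in> set fs"
  then have "ev x f \<in> set cs"
    using assms(2) by auto
  then have "ev x f = of_int 0 \<or> ev x f = of_int 1"
    using assms(3) by auto
  then show "ev y f = ev x f"
    unfolding ev_eq_int_iff[OF assms(1)] by auto
qed

text \<open>The length entry and the code are constant forms, so the tuple at \<open>y\<close> names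
  the same program and dimension; only the input part varies, and an equality-only machine does not
  notice.\<close>

lemma H1_eq_add_ev:
  assumes "x \<notin> \<rat>" "y \<notin> \<rat>" "map (ev x) fs \<in> H1_eq_add"
  shows "map (ev y) fs \<in> H1_eq_add"
proof -
  obtain n xs p where p: "map (ev x) fs = real n # xs @ code p" "n \<ge> 1" "length xs = n"
    "p \<in> M1_eq_add" "halts_on p xs"
    using assms(3) by (auto simp: H1_eq_add_def halting_problem_def)
  then obtain f gs hs where fs: "fs = f # gs @ hs" "ev x f = real n" "map (ev x) gs = xs"
    "map (ev x) hs = code p"
    by (auto simp: map_eq_Cons_conv map_eq_append_conv)
  have "f = (int n, 0)"
    using fs(2) ev_eq_int_iff[OF assms(1), of f "int n"] by simp
  then have "map (ev y) fs = real n # map (ev y) gs @ code p"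
    using fs map_ev_bits[OF assms(1) fs(4) set_code] by simp
  moreover have "halts_on p (map (ev y) gs)"
    using M1_eq_add_halts_ev[OF p(4) assms(1,2)] p(5) fs(3) by simp
  ultimately show ?thesis
    using p(2-4) fs(3) unfolding H1_eq_add_def halting_problem_def by fastforce
qed

text \<open>The evaluation points at which linear forms cannot be told apart by the oracle \<open>H k\<close>.\<close>

definition generic :: "nat \<Rightarrow> real set" where
  "generic k = {x. x \<notin> \<rat> \<and> (\<forall>j\<in>{1..k}. \<forall>f. ev x f \<noteq> sqrt (real (nth_prime j)))}"

text \<open>In an element of \<open>P_set j\<close> all entries but the third are constant forms,
  and for \<open>j \<le> k\<close> genericity of \<open>y\<close> keeps the third away from the
  excluded root.\<close>

lemma H_ev:
  assumes "x \<in> generic k" "y \<in> generic k" "map (ev x) fs \<in> H k"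
  shows "map (ev y) fs \<in> H k"
proof -
  have irr: "x \<notin> \<rat>" "y \<notin> \<rat>"
    using assms by (auto simp: generic_def)
  from assms(3) consider "map (ev x) fs \<in> H1_eq_add" | j where "j \<in> {1..k}" "map (ev x) fs \<in> P_set j"
    by (auto simp: H_def)
  then show ?thesis
  proof cases
    case 1
    then show ?thesis
      using H1_eq_add_ev[OF irr] by (auto simp: H_def)
  next
    case 2
    then obtain z where "map (ev x) fs = [2, real j, z] @ code machine_K"
      by (auto simp: P_set_def)
    then obtain f g h hs where fs: "fs = [f, g, h] @ hs" "ev x f = 2" "ev x g = real j"
      "map (ev x) hs = code machine_K"
      by (auto simp: map_eq_Cons_conv map_eq_append_conv)
    have "f = (2, 0)" "g = (int j, 0)"
      using fs ev_eq_int_iff[OF irr(1), of f 2] ev_eq_int_iff[OF irr(1), of g "int j"] by simp_all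
    then have "map (ev y) fs = [2, real j, ev y h] @ code machine_K"
      using fs map_ev_bits[OF irr(1) fs(4) set_code] by simp
    moreover have "ev y h \<noteq> sqrt (real (nth_prime j))"
      using assms(2) 2(1) unfolding generic_def by blast
    ultimately have "map (ev y) fs \<in> P_set j"
      by (auto simp: P_set_def)
    then show ?thesis
      using 2(1) by (auto simp: H_def)
  qed
qed

text \<open>A form vanishing at an irrational point is zero; any other keeps its sign nearby by
  continuity.\<close>

lemma nonneg_ev_locally_constant:
  assumes "x0 \<notin> \<rat>"
  shows "\<exists>\<delta>>0. \<exists>b. \<forall>x. \<bar>x - x0\<bar> < \<delta> \<longrightarrow> (0 \<le> ev x f) = b"
proof (cases "ev x0 f = 0")
  case True
  then have "f = (0, 0)"
    using ev_eq_0_iff[OF assms] by simp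
  then show ?thesis
    by (intro exI[of _ 1]) auto
next
  case False
  \<comment> \<open>Adding 1 keeps the Lipschitz bound positive for constant forms.\<close>
  let ?B = "\<bar>of_int (snd f) :: real\<bar> + 1"
  let ?d = "\<bar>ev x0 f\<bar> / ?B"
  have B: "?B > 0" by linarith
  have "(0 \<le> ev x f) = (0 \<le> ev x0 f)" if "\<bar>x - x0\<bar> < ?d" for x
  proof -
    have "\<bar>ev x f - ev x0 f\<bar> = \<bar>of_int (snd f)\<bar> * \<bar>x - x0\<bar>"
      by (simp add: ev_def flip: abs_mult) (simp add: algebra_simps)
    also have "\<dots> \<le> ?B * \<bar>x - x0\<bar>"
      by (rule mult_right_mono) auto
    also have "\<dots> < \<bar>ev x0 f\<bar>"
      using that B by (simp add: field_simps)
    finally show ?thesis by linarith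
  qed
  moreover have "?d > 0"
    using False B by simp
  ultimately show ?thesis by blast
qed

text \<open>The radius depends on \<open>n\<close>, as each order test may shrink it. Queries impose
  no restriction, since \<open>H_ev\<close> makes their answers equal at all generic points.\<close>

lemma H_oracle_run_ev:
  assumes "p \<in> M1_add_oracle" "x0 \<in> generic k"
  shows "\<exists>\<delta>>0. \<exists>l I F. l < length p \<and> (\<forall>x\<in>generic k. \<bar>x - x0\<bar> < \<delta> \<longrightarrow>
    (step (H k) p ^^ n) (init (map (ev x) fs)) = (l, I, \<lambda>i. ev x (F i)))"
proof (induction n)
  case 0
  have "0 < length p"
    using assms(1) by (auto simp: M1_add_oracle_def wf_prog_def)
  then show ?case
    using init_map_ev[of fs] by (metis funpow_0 zero_less_one)
next
  case (Suc n)
  then obtain \<delta> l I F where l: "\<delta> > 0" "l < length p"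
    and s: "\<And>x. x \<in> generic k \<Longrightarrow> \<bar>x - x0\<bar> < \<delta> \<Longrightarrow>
      (step (H k) p ^^ n) (init (map (ev x) fs)) = (l, I, \<lambda>i. ev x (F i))"
    by blast
  have "x0 \<notin> \<rat>"
    using assms(2) by (simp add: generic_def)
  \<comment> \<open>Register 0 is a dummy for instructions other than order tests, so that a radius
    can be chosen in every case.\<close>
  define j where "j = (case p ! l of IfNonneg j l1 l2 \<Rightarrow> j | _ \<Rightarrow> 0)"
  obtain \<epsilon> b where e: "\<epsilon> > 0" "\<forall>x. \<bar>x - x0\<bar> < \<epsilon> \<longrightarrow> (0 \<le> ev x (F j)) = b"
    using nonneg_ev_locally_constant[OF \<open>x0 \<notin> \<rat>\<close>, of "F j"] by (elim exE conjE)
  let ?T = "{x \<in> generic k. \<bar>x - x0\<bar> < min \<delta> \<epsilon>}"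
  have "\<exists>l' I' F'. l' < length p \<and>
    (\<forall>x\<in>?T. step (H k) p (l, I, \<lambda>i. ev x (F i)) = (l', I', \<lambda>i. ev x (F' i)))"
  proof (rule step_ev[OF assms(1) l(2)])
    fix x assume "x \<in> ?T"
    then show "x \<notin> \<rat>" by (simp add: generic_def)
  next
    fix j' l1 l2 assume "p ! l = IfNonneg j' l1 l2"
    then show "\<exists>b. \<forall>x\<in>?T. (0 \<le> ev x (F j')) = b"
      using e(2) by (intro exI[of _ b]) (simp add: j_def)
  next
    fix l1 l2
    show "\<exists>b. \<forall>x\<in>?T. (contents I (\<lambda>i. ev x (F i)) \<in> H k) = b"
    proof (intro exI ballI iffI)
      fix x assume "x \<in> ?T"
      then have x: "x \<in> generic k" by simp
      show "contents I (\<lambda>i. ev x0 (F i)) \<in> H k" if "contents I (\<lambda>i. ev x (F i)) \<in> H k"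
        using that H_ev[OF x assms(2)] unfolding contents_ev by blast
      show "contents I (\<lambda>i. ev x (F i)) \<in> H k" if "contents I (\<lambda>i. ev x0 (F i)) \<in> H k"
        using that H_ev[OF assms(2) x] unfolding contents_ev by blast
    qed
  qed
  then obtain l' I' F' where "l' < length p"
    "\<forall>x\<in>?T. step (H k) p (l, I, \<lambda>i. ev x (F i)) = (l', I', \<lambda>i. ev x (F' i))"
    by blast
  then have "l' < length p \<and> (\<forall>x\<in>generic k. \<bar>x - x0\<bar> < min \<delta> \<epsilon> \<longrightarrow>
    (step (H k) p ^^ Suc n) (init (map (ev x) fs)) = (l', I', \<lambda>i. ev x (F' i)))"
    using s by simp
  moreover have "min \<delta> \<epsilon> > 0" using l(1) e(1) by simp
  ultimately show ?case by blast
qed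

section \<open>Square roots of distinct primes\<close>

lemma sqrt_nat_rational_imp_square:
  assumes "sqrt (real n) \<in> \<rat>"
  shows "\<exists>m. n = m * m"
proof -
  obtain a b :: nat where ab: "b \<noteq> 0" "\<bar>sqrt (real n)\<bar> = real a / real b" "coprime a b"
    using Rats_abs_nat_div_natE[OF assms] by metis
  then have "real n = (real a / real b)\<^sup>2"
    by (metis abs_of_nonneg of_nat_0_le_iff real_sqrt_ge_zero real_sqrt_pow2)
  then have "real n * (real b * real b) = real a * real a"
    using ab(1) by (simp add: field_simps power2_eq_square)
  then have eq: "n * (b * b) = a * a"
    by (metis of_nat_eq_iff of_nat_mult)
  then have "b dvd a * a"
    by (metis dvd_mult dvd_triv_left)
  moreover have "coprime b (a * a)"
    using ab(3) by (simp add: coprime_commute)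
  ultimately have "b = 1"
    by (metis coprime_common_divisor dvd_refl nat_dvd_1_iff_1)
  then show ?thesis using eq by auto
qed

lemma sqrt_prime_irrational:
  assumes "prime p"
  shows "sqrt (real p) \<notin> \<rat>"
proof
  assume "sqrt (real p) \<in> \<rat>"
  then obtain m where "p = m * m"
    using sqrt_nat_rational_imp_square by blast
  then show False
    using assms by (metis nat_mult_1_right not_prime_1 prime_product)
qed

lemma sqrt_prime_not_in_quadratic_field:
  assumes "prime p" "prime q" "p \<noteq> q" "a \<in> \<rat>" "b \<in> \<rat>"
  shows "a + b * sqrt (real q) \<noteq> sqrt (real p)"
proof
  assume eq: "a + b * sqrt (real q) = sqrt (real p)"
  have q: "sqrt (real q) * sqrt (real q) = real q" by simp
  have p: "sqrt (real p) * sqrt (real p) = real p" by simp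
  have "2 * a * b * sqrt (real q) = sqrt (real p) * sqrt (real p) - a * a - b * b * (sqrt (real q) * sqrt (real q))"
    unfolding eq[symmetric] by (simp add: algebra_simps)
  then have *: "2 * a * b * sqrt (real q) = real p - a * a - b * b * real q"
    unfolding p q .
  have rat: "real p - a * a - b * b * real q \<in> \<rat>"
    using assms(4,5) by simp
  have "a * b = 0"
  proof (rule ccontr)
    assume "a * b \<noteq> 0"
    then have "sqrt (real q) = (real p - a * a - b * b * real q) / (2 * a * b)"
      using * by (simp add: field_simps)
    then have "sqrt (real q) \<in> \<rat>"
      using rat assms(4,5) by simp
    then show False
      using sqrt_prime_irrational[OF assms(2)] by blast
  qed
  then consider "b = 0" | "a = 0" by auto
  then show False
  proof cases
    case 1
    then show ?thesis
      using eq assms(4) sqrt_prime_irrational[OF assms(1)] by simp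
  next
    case 2
    \<comment> \<open>Multiply \<open>b * sqrt q = sqrt p\<close> by \<open>sqrt q\<close>; then
      \<open>p * q\<close> would be a perfect square.\<close>
    then have "sqrt (real (p * q)) = b * real q"
      using eq q by (simp add: real_sqrt_mult mult.assoc flip: eq)
    then have "sqrt (real (p * q)) \<in> \<rat>"
      using assms(5) by simp
    then obtain m where m: "p * q = m * m"
      using sqrt_nat_rational_imp_square by blast
    then have "p dvd m"
      using assms(1) by (metis dvd_triv_left prime_dvd_mult_iff)
    then obtain n where "m = p * n" by blast
    then have "q = n * p * n"
      using m prime_gt_0_nat[OF assms(1)] by simp
    then have "p dvd q" by simp
    then show ?thesis
      using assms(1-3) primes_dvd_imp_eq by blast
  qed
qed

lemma strict_mono_nth_prime: "1 \<le> i \<Longrightarrow> i < j \<Longrightarrow> nth_prime i < nth_prime j"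
  by (simp add: nth_prime_def enumerate_mono infinite_primes_nat)

text \<open>A shift by \<open>r\<close> changes only the rational part of a form, so its values
  remain in the field generated by one root, which misses the roots of primes with smaller
  index.\<close>

lemma sqrt_nth_prime_plus_rational_generic:
  assumes "r \<in> \<rat>"
  shows "sqrt (real (nth_prime (Suc k))) + r \<in> generic k"
proof -
  let ?q = "nth_prime (Suc k)"
  have primes: "prime (nth_prime j)" for j
    by (simp add: nth_prime_def prime_enumerate)
  have "sqrt (real ?q) + r \<notin> \<rat>"
    using sqrt_prime_irrational[OF primes[of "Suc k"]] assms
    by (metis Rats_diff add_diff_cancel_right')
  moreover have "ev (sqrt (real ?q) + r) f \<noteq> sqrt (real (nth_prime j))" if "j \<in> {1..k}" for j f
  proof -
    have "ev (sqrt (real ?q) + r) f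
        = (of_int (fst f) + of_int (snd f) * r) + of_int (snd f) * sqrt (real ?q)"
      by (simp add: ev_def algebra_simps)
    moreover have "nth_prime j \<noteq> ?q"
      using strict_mono_nth_prime[of j "Suc k"] that by simp
    ultimately show ?thesis
      using sqrt_prime_not_in_quadratic_field[OF primes primes, of j "Suc k"
          "of_int (fst f) + of_int (snd f) * r" "of_int (snd f)"] assms by simp
  qed
  ultimately show ?thesis
    by (simp add: generic_def)
qed

section \<open>The oracle \<open>H k\<close> cannot detect the next root\<close>

text \<open>Only inputs with index \<open>Suc k\<close> enter the hypothesis, so that one argument
  serves both \<open>H (Suc k)\<close> and the full union.\<close>

lemma not_reducible_to_H:
  assumes B: "\<And>x. [2, real (Suc k), x] @ code machine_K \<in> B \<longleftrightarrow> x \<noteq> sqrt (real (nth_prime (Suc k)))"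
  shows "\<not> B \<preceq> H k"
proof
  assume "B \<preceq> H k"
  then obtain p where p: "p \<in> M1_add_oracle"
    "\<And>xs. xs \<noteq> [] \<Longrightarrow> computes (H k) p xs [if xs \<in> B then 1 else 0]"
    by (auto simp: reducible_def)
  define x0 where "x0 = sqrt (real (nth_prime (Suc k)))"
  define fs :: "(int \<times> int) list" where "fs = [(2, 0), (int (Suc k), 0), (0, 1)]
    @ map (\<lambda>b. if b = 0 then (0, 0) else (1, 0)) (code machine_K)"
  have fs: "map (ev x) fs = [2, real (Suc k), x] @ code machine_K" for x
  proof -
    have "map (ev x) (map (\<lambda>b. if b = 0 then (0, 0) else (1, 0)) cs) = cs"
      if "set cs \<subseteq> {0, 1}" for cs
      using that by (induction cs) auto
    then show ?thesis
      using set_code[of machine_K] by (simp add: fs_def)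
  qed
  have gen: "x0 + r \<in> generic k" if "r \<in> \<rat>" for r
    using sqrt_nth_prime_plus_rational_generic[OF that] by (simp add: x0_def)
  have "computes (H k) p (map (ev x0) fs) [0]"
    using p(2)[of "map (ev x0) fs"] B[of x0] unfolding fs x0_def by simp
  then obtain n l0 I0 Z0 where run0: "(step (H k) p ^^ n) (init (map (ev x0) fs)) = (l0, I0, Z0)"
    "p ! l0 = Stop" "[0] = contents I0 Z0"
    by (auto simp: computes_def)
  obtain \<delta> l I F where d: "\<delta> > 0" and run: "\<And>x. x \<in> generic k \<Longrightarrow> \<bar>x - x0\<bar> < \<delta> \<Longrightarrow>
      (step (H k) p ^^ n) (init (map (ev x) fs)) = (l, I, \<lambda>i. ev x (F i))"
    using H_oracle_run_ev[OF p(1), of x0 k n fs] gen[of 0] by auto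
  have same: "(l, I, \<lambda>i. ev x0 (F i)) = (l0, I0, Z0)"
    using run0(1) run[of x0] gen[of 0] d by simp
  then have stop: "p ! l = Stop"
    using run0(2) by simp
  define gs where "gs = map F [1..<Suc (I 1)]"
  have contents: "contents I (\<lambda>i. ev x (F i)) = map (ev x) gs" for x
    by (simp only: contents_ev gs_def)
  have "map (ev x0) gs = [0]"
    using run0(3) same unfolding contents[symmetric] by (metis prod.inject)
  then obtain f where f: "gs = [f]" "ev x0 f = 0"
    by (auto simp: map_eq_Cons_conv)
  \<comment> \<open>The output at \<open>x0\<close> is the value 0 of a single form; irrationality
    makes this the zero form, so nearby generic inputs also yield 0.\<close>
  have "f = (0, 0)"
    using f(2) ev_eq_0_iff[of x0 f] gen[of 0] by (simp add: generic_def)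
  \<comment> \<open>A nonzero rational shift within the radius.\<close>
  obtain m where m: "inverse (real (Suc m)) < \<delta>"
    using reals_Archimedean[OF d] by blast
  define x where "x = x0 + inverse (real (Suc m))"
  have "x \<in> generic k"
    unfolding x_def by (rule gen) simp
  moreover have "\<bar>x - x0\<bar> < \<delta>" "x \<noteq> x0"
    using m by (simp_all add: x_def)
  ultimately have "computes (H k) p (map (ev x) fs) [0]"
    using run[of x] stop contents[of x] f(1) \<open>f = (0, 0)\<close> unfolding computes_def
    by fastforce
  moreover have "computes (H k) p (map (ev x) fs) [1]"
    using p(2)[of "map (ev x) fs"] B[of x] \<open>x \<noteq> x0\<close> unfolding fs x0_def by simp
  ultimately show False
    using computes_unique by fastforce
qed

section \<open>A machine running a finite automaton on the program code\<close>

definition jump :: "nat \<Rightarrow> instr" where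
  "jump l = IfIdxEq 1 1 l l"

lemma step_jump: "p ! l = jump l' \<Longrightarrow> step Q p (l, I, Z) = (l', I, Z)"
  by (simp add: jump_def)

text \<open>
  State \<open>s\<close> of the automaton occupies the four instructions starting at label \<open>D + 4 s\<close>.  The bit is
  read from address \<open>I\<^sub>3\<close> into \<open>Z\<^sub>1\<close> (as \<open>I\<^sub>5 = 1\<close>), and the run ends when \<open>I\<^sub>3\<close> reaches \<open>I\<^sub>2\<close>.
\<close>

definition automaton_instr ::
  "nat \<Rightarrow> nat \<Rightarrow> (nat \<Rightarrow> bool \<Rightarrow> nat) \<Rightarrow> (nat \<Rightarrow> bool) \<Rightarrow> nat \<Rightarrow> instr" where
  "automaton_instr D m \<delta> acc i = (let s = i div 4 in
     [IfIdxEq 3 2 (if acc s then D + 4 * m else D + 4 * m + 3) (D + 4 * s + 1),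
      Copy 5 3, IdxInc 3, IfZero 1 (D + 4 * \<delta> s True) (D + 4 * \<delta> s False)] ! (i mod 4))"

text \<open>
  On an input in the oracle set, of length \<open>N\<close> starting with \<open>n\<close>, \<open>I\<^sub>2 = N + 1\<close> points behind the input, where
  \<open>Z\<^sub>1\<close> is saved while \<open>Z\<^sub>2\<close> is compared with \<open>1, \<dots>, k\<close>.  The outcome is kept in \<open>I\<^sub>4\<close>, as 4 or 1:
  the code starts at address \<open>I\<^sub>3 = n + 2 \<ge> 3\<close>, so \<open>I\<^sub>3 = I\<^sub>4\<close> holds iff the comparison succeeded and
  \<open>n = 2\<close>.  Only \<open>Z\<^sub>1, Z\<^sub>2\<close> and \<open>Z\<^bsub>N+1\<^esub>\<close> are overwritten, hence the code stays intact.
\<close>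

definition reducer ::
  "nat \<Rightarrow> bool \<Rightarrow> nat \<Rightarrow> (nat \<Rightarrow> bool \<Rightarrow> nat) \<Rightarrow> (nat \<Rightarrow> bool) \<Rightarrow> nat \<Rightarrow> nat \<Rightarrow> prog" where
  "reducer k all m \<delta> acc s0 s1 = (let T = 2 * k + 7; D = 2 * k + 18; E = D + 4 * m in
     [IfOracle 1 (E + 3), IdxInc 2, IdxOne 3, Copy 2 3, SetConst 1 1, IdxOne 4]
     @ map (\<lambda>i. if even i then Sub 2 2 1 else IfZero 2 T (i + 7)) [0..<2 * k]
     @ [jump (if all then T else T + 3),
        IdxInc 4, IdxInc 4, IdxInc 4,
        Copy 3 2, SetConst 2 1,
        Sub 1 1 2, IdxInc 3, IfZero 1 (T + 8) (T + 5),
        IdxInc 3, IdxOne 5, IfIdxEq 3 4 (D + 4 * s1) (D + 4 * s0)]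
     @ map (automaton_instr D m \<delta> acc) [0..<4 * m]
     @ [IdxOne 1, SetConst 1 1, jump (E + 5), IdxOne 1, SetConst 1 0, Stop])"

lemma nth_append_right: "length xs = n \<Longrightarrow> (xs @ ys) ! (n + i) = ys ! i"
  by (simp add: nth_append)

context
  fixes k m s0 s1 :: nat and all :: bool and \<delta> :: "nat \<Rightarrow> bool \<Rightarrow> nat" and acc :: "nat \<Rightarrow> bool"
  assumes start_states: "s0 < m" "s1 < m" and \<delta>_less: "\<And>s z. s < m \<Longrightarrow> \<delta> s z < m"
begin

abbreviation (input) "R \<equiv> reducer k all m \<delta> acc s0 s1"
abbreviation (input) "D \<equiv> 2 * k + 18"
abbreviation (input) "E \<equiv> 2 * k + 18 + 4 * m"
abbreviation (input) "T \<equiv> 2 * k + 7"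

lemma length_reducer: "length R = E + 6"
  by (simp add: reducer_def Let_def)

lemma reducer_nth_start:
  "R ! 0 = IfOracle 1 (E + 3)" "R ! 1 = IdxInc 2" "R ! 2 = IdxOne 3" "R ! 3 = Copy 2 3"
  "R ! 4 = SetConst 1 1" "R ! 5 = IdxOne 4"
  by (simp_all add: reducer_def Let_def)

lemma reducer_nth_tests:
  assumes "i < k"
  shows "R ! (2 * i + 6) = Sub 2 2 1" "R ! (2 * i + 7) = IfZero 2 T (2 * i + 8)"
proof -
  have "R ! (6 + j) = (if even j then Sub 2 2 1 else IfZero 2 T (j + 7))" if "j < 2 * k" for j
    unfolding reducer_def Let_def using that
    by (subst nth_append_right) (simp_all add: nth_append)
  from this[of "2 * i"] this[of "2 * i + 1"] assms
  show "R ! (2 * i + 6) = Sub 2 2 1" "R ! (2 * i + 7) = IfZero 2 T (2 * i + 8)"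
    by (simp_all add: add.commute)
qed

lemma reducer_nth_middle:
  "R ! (2 * k + 6) = jump (if all then T else T + 3)"
  "R ! (2 * k + 7) = IdxInc 4" "R ! (2 * k + 8) = IdxInc 4" "R ! (2 * k + 9) = IdxInc 4"
  "R ! (2 * k + 10) = Copy 3 2" "R ! (2 * k + 11) = SetConst 2 1"
  "R ! (2 * k + 12) = Sub 1 1 2" "R ! (2 * k + 13) = IdxInc 3"
  "R ! (2 * k + 14) = IfZero 1 (2 * k + 15) (2 * k + 12)"
  "R ! (2 * k + 15) = IdxInc 3" "R ! (2 * k + 16) = IdxOne 5"
  "R ! (2 * k + 17) = IfIdxEq 3 4 (D + 4 * s1) (D + 4 * s0)"
  by (simp_all add: reducer_def Let_def nth_append)

lemma reducer_nth_automaton: "i < 4 * m \<Longrightarrow> R ! (D + i) = automaton_instr D m \<delta> acc i"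
  by (simp add: reducer_def Let_def nth_append)

lemma reducer_nth_end:
  "R ! E = IdxOne 1" "R ! (E + 1) = SetConst 1 1" "R ! (E + 2) = jump (E + 5)"
  "R ! (E + 3) = IdxOne 1" "R ! (E + 4) = SetConst 1 0" "R ! (E + 5) = Stop"
  by (simp_all add: reducer_def Let_def nth_append)

lemma reducer_nth_block:
  assumes "s < m"
  shows "R ! (D + 4 * s) = IfIdxEq 3 2 (if acc s then E else E + 3) (D + 4 * s + 1)"
    "R ! (D + 4 * s + 1) = Copy 5 3" "R ! (D + 4 * s + 2) = IdxInc 3"
    "R ! (D + 4 * s + 3) = IfZero 1 (D + 4 * \<delta> s True) (D + 4 * \<delta> s False)"
proof -
  have "R ! (D + 4 * s + r) = [IfIdxEq 3 2 (if acc s then E else E + 3) (D + 4 * s + 1),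
      Copy 5 3, IdxInc 3, IfZero 1 (D + 4 * \<delta> s True) (D + 4 * \<delta> s False)] ! r" if "r < 4" for r
  proof -
    have "(4 * s + r) div 4 = s" "(4 * s + r) mod 4 = r"
      using that by simp_all
    then show ?thesis
      using reducer_nth_automaton[of "4 * s + r"] assms that
      by (simp add: add.assoc automaton_instr_def)
  qed
  from this[of 0] this[of 1] this[of 2] this[of 3]
  show "R ! (D + 4 * s) = IfIdxEq 3 2 (if acc s then E else E + 3) (D + 4 * s + 1)"
    "R ! (D + 4 * s + 1) = Copy 5 3" "R ! (D + 4 * s + 2) = IdxInc 3"
    "R ! (D + 4 * s + 3) = IfZero 1 (D + 4 * \<delta> s True) (D + 4 * \<delta> s False)"
    by simp_all
qed

lemma wf_automaton_instr:
  assumes "i < 4 * m"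
  shows "wf_instr (E + 6) (automaton_instr D m \<delta> acc i)"
proof -
  have s: "i div 4 < m" using assms by simp
  have "\<delta> (i div 4) z < m" for z using \<delta>_less[OF s] .
  then have d: "D + 4 * \<delta> (i div 4) z < E + 6" for z
    by (metis add_less_mono1 add.assoc add_less_cancel_left mult_less_mono2 trans_less_add1 zero_less_numeral)
  have "i mod 4 = 0 \<or> i mod 4 = 1 \<or> i mod 4 = 2 \<or> i mod 4 = 3" by linarith
  then show ?thesis
    using s d[of True] d[of False] by (elim disjE) (simp_all add: automaton_instr_def Let_def)
qed

lemma automaton_instr_not_SetConst:
  "automaton_instr D' m \<delta> acc i \<noteq> SetConst j c"
proof -
  have "i mod 4 = 0 \<or> i mod 4 = 1 \<or> i mod 4 = 2 \<or> i mod 4 = 3" by linarith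
  then show ?thesis
    by (elim disjE) (simp_all add: automaton_instr_def Let_def)
qed

lemma reducer_in_M1_add_oracle: "R \<in> M1_add_oracle"
proof -
  have "wf_instr (length R) a" if "a \<in> set R" for a
    using that start_states wf_automaton_instr unfolding length_reducer
    by (auto simp: reducer_def Let_def jump_def)
  moreover have "R \<noteq> []" "last R = Stop"
    by (simp_all add: reducer_def Let_def)
  moreover have "c \<in> {0, 1}" if "SetConst j c \<in> set R" for j c
    using that automaton_instr_not_SetConst[of D _ j c]
    by (auto simp: reducer_def Let_def jump_def split: if_splits) (metis automaton_instr_not_SetConst)+
  ultimately show ?thesis
    by (simp add: M1_add_oracle_def wf_prog_def)
qed

text \<open>Reading a bit overwrites \<open>Z 1\<close>; the condition \<open>1 < I 3\<close> keeps
  this address out of the unread part, so the remaining word is unchanged.\<close>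

lemma reducer_automaton:
  assumes "s < m" "I 5 = 1" "1 < I 3" "I 3 \<le> I 2"
  shows "leads Q R (D + 4 * s, I, Z) (\<lambda>(l, _, _).
    l = (if acc (foldl (\<lambda>s b. \<delta> s (b = 0)) s (map Z [I 3..<I 2])) then E else E + 3))"
  using assms
proof (induction "I 2 - I 3" arbitrary: s I Z rule: less_induct)
  case less
  note nth = reducer_nth_block[OF less.prems(1)]
  show ?case
  proof (cases "I 3 = I 2")
    case True
    then show ?thesis
      by (intro leads_step[of Q R "(D + 4 * s, I, Z)"] leads_now) (simp add: nth)
  next
    case False
    let ?I = "I(3 := I 3 + 1)" and ?Z = "Z(1 := Z (I 3))"
    let ?s = "\<delta> s (Z (I 3) = 0)"
    have ih: "leads Q R (D + 4 * ?s, ?I, ?Z) (\<lambda>(l, _, _).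
      l = (if acc (foldl (\<lambda>s b. \<delta> s (b = 0)) ?s (map ?Z [?I 3..<?I 2])) then E else E + 3))"
      by (rule less.hyps) (use less.prems False \<delta>_less in auto)
    have "map ?Z [?I 3..<?I 2] = map Z [I 3 + 1..<I 2]"
      using less.prems by simp
    moreover have "map Z [I 3..<I 2] = Z (I 3) # map Z [I 3 + 1..<I 2]"
      using less.prems False by (simp add: upt_rec)
    ultimately have fold: "foldl (\<lambda>s b. \<delta> s (b = 0)) s (map Z [I 3..<I 2])
        = foldl (\<lambda>s b. \<delta> s (b = 0)) ?s (map ?Z [?I 3..<?I 2])"
      by (simp only: foldl_Cons)
    have 1: "step Q R (D + 4 * s, I, Z) = (D + 4 * s + 1, I, Z)"
      using False by (simp add: nth)
    have 2: "step Q R (D + 4 * s + 1, I, Z) = (D + 4 * s + 2, I, ?Z)"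
      unfolding step.simps nth using less.prems(2) by simp
    have 3: "step Q R (D + 4 * s + 2, I, ?Z) = (D + 4 * s + 3, ?I, ?Z)"
      unfolding step.simps nth by simp
    have 4: "step Q R (D + 4 * s + 3, ?I, ?Z) = (D + 4 * ?s, ?I, ?Z)"
      unfolding step.simps nth by simp
    show ?thesis
      apply (rule leads_step, subst 1, rule leads_step, subst 2)
      apply (rule leads_step, subst 3, rule leads_step, subst 4)
      unfolding fold by (rule ih)
  qed
qed

text \<open>Register 1 temporarily supplies the constant 1 for decrementing register 2; the set
  \<open>{i<..k}\<close> holds the indices still to be compared.\<close>

lemma reducer_tests:
  assumes "i \<le> k" "Z 1 = 1" "Z 2 = z - real i"
  shows "leads Q R (2 * i + 6, I, Z) (\<lambda>(l, I', Z'). I' = I \<and> (\<forall>n. n \<noteq> 2 \<longrightarrow> Z' n = Z n)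
    \<and> l = (if \<exists>j\<in>{i<..k}. z = real j then T else 2 * k + 6))"
  using assms
proof (induction "k - i" arbitrary: i Z)
  case 0
  then show ?case
    by (intro leads_now) auto
next
  case (Suc d)
  then have i: "i < k" by simp
  note nth = reducer_nth_tests[OF i]
  let ?Z = "Z(2 := z - real (Suc i))"
  have 1: "step Q R (2 * i + 6, I, Z) = (2 * i + 7, I, ?Z)"
    unfolding step.simps nth using Suc.prems by (simp add: fun_eq_iff)
  show ?case
  proof (cases "z = real (Suc i)")
    case True
    have 2: "step Q R (2 * i + 7, I, ?Z) = (T, I, ?Z)"
      unfolding step.simps nth using True by simp
    have "\<exists>j\<in>{i<..k}. z = real j"
      using True i by (intro bexI[of _ "Suc i"]) auto
    then show ?thesis
      apply -
      apply (rule leads_step, subst 1, rule leads_step, subst 2)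
      by (rule leads_now) simp
  next
    case False
    have 2: "step Q R (2 * i + 7, I, ?Z) = (2 * Suc i + 6, I, ?Z)"
      unfolding step.simps nth using False by simp
    have ih: "leads Q R (2 * Suc i + 6, I, ?Z) (\<lambda>(l, I', Z'). I' = I \<and> (\<forall>n. n \<noteq> 2 \<longrightarrow> Z' n = ?Z n)
      \<and> l = (if \<exists>j\<in>{Suc i<..k}. z = real j then T else 2 * k + 6))"
      by (rule Suc.hyps(1)) (use Suc i in auto)
    have "(\<exists>j\<in>{Suc i<..k}. z = real j) = (\<exists>j\<in>{i<..k}. z = real j)"
      using False by (metis Suc_lessI greaterThanAtMost_iff less_SucI Suc_lessD)
    then show ?thesis
      apply -
      apply (rule leads_step, subst 1, rule leads_step, subst 2)
      using ih by simp
  qed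
qed

text \<open>Real registers cannot be copied into index registers, so the real \<open>n\<close> is
  counted down while \<open>I 3\<close> is counted up; the decrement precedes the test, hence
  \<open>n \<ge> 1\<close>.\<close>

lemma reducer_skip:
  assumes "n \<ge> 1" "Z 1 = real n" "Z 2 = 1"
  shows "leads Q R (2 * k + 12, I, Z) (\<lambda>c. c = (2 * k + 15, I(3 := I 3 + n), Z(1 := 0)))"
  using assms
proof (induction n arbitrary: I Z)
  case (Suc n)
  let ?I = "I(3 := I 3 + 1)" and ?Z = "Z(1 := real n)"
  have 1: "step Q R (2 * k + 12, I, Z) = (2 * k + 13, I, ?Z)"
    unfolding step.simps reducer_nth_middle using Suc.prems by (simp add: fun_eq_iff)
  have 2: "step Q R (2 * k + 13, I, ?Z) = (2 * k + 14, ?I, ?Z)"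
    unfolding step.simps reducer_nth_middle by simp
  have 3: "step Q R (2 * k + 14, ?I, ?Z) = (if n = 0 then 2 * k + 15 else 2 * k + 12, ?I, ?Z)"
    unfolding step.simps reducer_nth_middle by simp
  show ?case
  proof (cases "n = 0")
    case True
    then show ?thesis
      apply -
      apply (rule leads_step, subst 1, rule leads_step, subst 2, rule leads_step, subst 3)
      by (rule leads_now) simp
  next
    case False
    have "leads Q R (2 * k + 12, ?I, ?Z) (\<lambda>c. c = (2 * k + 15, ?I(3 := ?I 3 + n), ?Z(1 := 0)))"
      by (rule Suc.IH) (use False Suc.prems in auto)
    then show ?thesis
      apply -
      apply (rule leads_step, subst 1, rule leads_step, subst 2, rule leads_step, subst 3)
      using False by simp
  qed
qed simp

text \<open>The output extends up to address \<open>I 1\<close>, so \<open>I 1\<close> is reset to 1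
  before the result is written.\<close>

lemma reducer_answer:
  assumes "l = (if b then E else E + 3)"
  shows "leads Q R (l, I, Z) (\<lambda>(l, I, Z). R ! l = Stop \<and> [if b then 1 else 0] = contents I Z)"
proof (cases b)
  case True
  have 1: "step Q R (E, I, Z) = (E + 1, I(1 := 1), Z)"
    unfolding step.simps reducer_nth_end by simp
  have 2: "step Q R (E + 1, I(1 := 1), Z) = (E + 2, I(1 := 1), Z(1 := 1))"
    unfolding step.simps reducer_nth_end by simp
  have 3: "step Q R (E + 2, I(1 := 1), Z(1 := 1)) = (E + 5, I(1 := 1), Z(1 := 1))"
    by (rule step_jump) (rule reducer_nth_end)
  have "leads Q R (E, I, Z) (\<lambda>c. c = (E + 5, I(1 := 1), Z(1 := 1)))"
    by (rule leads_step, subst 1, rule leads_step, subst 2, rule leads_step, subst 3)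
      (rule leads_now, rule refl)
  then show ?thesis
    unfolding assms if_P[OF True]
    by (rule leads_trans) (use reducer_nth_end(6) in \<open>auto intro!: leads_now simp: contents_def\<close>)
next
  case False
  have 1: "step Q R (E + 3, I, Z) = (E + 4, I(1 := 1), Z)"
    unfolding step.simps reducer_nth_end by simp
  have 2: "step Q R (E + 4, I(1 := 1), Z) = (E + 5, I(1 := 1), Z(1 := 0))"
    unfolding step.simps reducer_nth_end by simp
  have "leads Q R (E + 3, I, Z) (\<lambda>c. c = (E + 5, I(1 := 1), Z(1 := 0)))"
    by (rule leads_step, subst 1, rule leads_step, subst 2) (rule leads_now, rule refl)
  then show ?thesis
    unfolding assms if_not_P[OF False]
    by (rule leads_trans) (use reducer_nth_end(6) in \<open>auto intro!: leads_now simp: contents_def\<close>)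
qed

text \<open>\<open>I 1\<close> initially holds the input length, so a query as first instruction
  asks about the input itself.\<close>

lemma contents_init: "xs \<noteq> [] \<Longrightarrow> contents (\<lambda>_. length xs) (load xs) = xs"
  by (rule nth_equalityI) (auto simp: contents_def load_def simp del: upt_Suc)

lemma reducer_computes_not_mem:
  assumes "xs \<noteq> []" "xs \<notin> B"
  shows "computes B R xs [0]"
proof -
  have 0: "step B R (init xs) = (E + 3, \<lambda>_. length xs, load xs)"
    unfolding init_def step.simps reducer_nth_start using assms by (simp add: contents_init)
  have "leads B R (E + 3, \<lambda>_. length xs, load xs)
      (\<lambda>(l, I, Z). R ! l = Stop \<and> [if False then 1 else 0] = contents I Z)"
    by (rule reducer_answer) simp
  then show ?thesis
    unfolding computes_iff_leads by (intro leads_step[of B R "init xs"]) (simp only: 0 if_False)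
qed

text \<open>The start state of the automaton carries the outcome of the index test through the scan
  of the code. As \<open>n \<ge> 1\<close>, register 2 initially holds \<open>hd ys\<close>.\<close>

lemma reducer_computes_mem:
  assumes xs: "xs \<in> B" "xs = real n # ys @ cs" "length ys = n" "n \<ge> 1"
  shows "computes B R xs [if acc (foldl (\<lambda>s b. \<delta> s (b = 0))
    (if n = 2 \<and> (all \<or> (\<exists>j\<in>{1..k}. hd ys = real j)) then s1 else s0) cs) then 1 else 0]"
proof -
  let ?N = "length xs"
  let ?f = "all \<or> (\<exists>j\<in>{1..k}. hd ys = real j)"
  let ?b = "acc (foldl (\<lambda>s b. \<delta> s (b = 0)) (if n = 2 \<and> ?f then s1 else s0) cs)"
  let ?I = "(\<lambda>_. ?N)(2 := ?N + 1, 3 := 1, 4 := 1) :: nat \<Rightarrow> nat"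
  let ?Z = "(load xs)(?N + 1 := real n, 1 := 1)"
  have N: "?N = n + 1 + length cs"
    using xs by simp
  have "xs \<noteq> []" using xs by simp
  have load1: "load xs 1 = real n"
    using xs by (simp add: load_def)
  have load2: "load xs 2 = hd ys"
    using xs by (cases ys) (auto simp: load_def)
  have 0: "step B R (init xs) = (1, \<lambda>_. ?N, load xs)"
    unfolding init_def step.simps reducer_nth_start
    using xs(1) contents_init[OF \<open>xs \<noteq> []\<close>] by simp
  have 1: "step B R (1, \<lambda>_. ?N, load xs) = (2, (\<lambda>_. ?N)(2 := ?N + 1), load xs)"
    unfolding step.simps reducer_nth_start by simp
  have 2: "step B R (2, (\<lambda>_. ?N)(2 := ?N + 1), load xs)
      = (3, (\<lambda>_. ?N)(2 := ?N + 1, 3 := 1), load xs)"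
    unfolding step.simps reducer_nth_start by simp
  have 3: "step B R (3, (\<lambda>_. ?N)(2 := ?N + 1, 3 := 1), load xs)
      = (4, (\<lambda>_. ?N)(2 := ?N + 1, 3 := 1), (load xs)(?N + 1 := real n))"
    unfolding step.simps reducer_nth_start using load1 by simp
  have 4: "step B R (4, (\<lambda>_. ?N)(2 := ?N + 1, 3 := 1), (load xs)(?N + 1 := real n))
      = (5, (\<lambda>_. ?N)(2 := ?N + 1, 3 := 1), ?Z)"
    unfolding step.simps reducer_nth_start by simp
  have 5: "step B R (5, (\<lambda>_. ?N)(2 := ?N + 1, 3 := 1), ?Z) = (6, ?I, ?Z)"
    unfolding step.simps reducer_nth_start by simp
  have start: "leads B R (init xs) (\<lambda>c. c = (6, ?I, ?Z))"
    by (rule leads_step, subst 0, rule leads_step, subst 1, rule leads_step, subst 2,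
        rule leads_step, subst 3, rule leads_step, subst 4, rule leads_step, subst 5)
      (rule leads_now, rule refl)
  let ?P1 = "\<lambda>(l, I', Z'). I' = ?I \<and> (\<forall>i. i \<noteq> 2 \<longrightarrow> Z' i = ?Z i)
    \<and> l = (if \<exists>j\<in>{0<..k}. hd ys = real j then T else 2 * k + 6)"
  have "leads B R (2 * 0 + 6, ?I, ?Z) ?P1"
    by (rule reducer_tests) (use load2 N xs(4) in auto)
  then have tests: "leads B R (6, ?I, ?Z) ?P1"
    by simp
  let ?I4 = "\<lambda>f. ?I(4 := if f then 4 else 1 :: nat)"
  have select: "leads B R c (\<lambda>(l, I', Z'). l = 2 * k + 10 \<and> I' = ?I4 ?f \<and> (\<forall>i. i \<noteq> 2 \<longrightarrow> Z' i = ?Z i))"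
    if "?P1 c" for c :: config
  proof -
    obtain l I' Z' where c': "c = (l, I', Z')"
      by (cases c)
    have c: "c = (l, ?I, Z')" "\<forall>i. i \<noteq> 2 \<longrightarrow> Z' i = ?Z i"
      "l = (if \<exists>j\<in>{0<..k}. hd ys = real j then T else 2 * k + 6)"
      using that unfolding c' prod.case by blast+
    have set_eq: "{0<..k} = {1..k}" by auto
    have inc: "leads B R (T, ?I, Z') (\<lambda>c. c = (2 * k + 10, ?I4 True, Z'))"
    proof -
      have 1: "step B R (T, ?I, Z') = (2 * k + 8, ?I(4 := 2), Z')"
        unfolding step.simps reducer_nth_middle by (simp flip: numeral_2_eq_2)
      have 2: "step B R (2 * k + 8, ?I(4 := 2), Z') = (2 * k + 9, ?I(4 := 3), Z')"
        unfolding step.simps reducer_nth_middle by simp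
      have 3: "step B R (2 * k + 9, ?I(4 := 3), Z') = (2 * k + 10, ?I4 True, Z')"
        unfolding step.simps reducer_nth_middle by simp
      show ?thesis
        by (rule leads_step, subst 1, rule leads_step, subst 2, rule leads_step, subst 3)
          (rule leads_now, rule refl)
    qed
    have "leads B R c (\<lambda>c. c = (2 * k + 10, ?I4 ?f, Z'))"
    proof (cases "\<exists>j\<in>{1..k}. hd ys = real j")
      case True
      then show ?thesis
        using inc c(1,3) unfolding set_eq by simp
    next
      case False
      have 1: "step B R (2 * k + 6, ?I, Z') = (if all then T else T + 3, ?I, Z')"
        by (rule step_jump) (rule reducer_nth_middle)
      have "leads B R (if all then T else T + 3, ?I, Z') (\<lambda>c. c = (2 * k + 10, ?I4 ?f, Z'))"
      proof (cases all)
        case True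
        then show ?thesis using inc by simp
      next
        case f: False
        then have "(if all then T else T + 3, ?I, Z') = (2 * k + 10, ?I4 ?f, Z')"
          using False by auto
        then show ?thesis by (rule leads_now)
      qed
      moreover have "c = (2 * k + 6, ?I, Z')"
        using c(1,3) False unfolding set_eq by simp
      ultimately show ?thesis
        using leads_step[of B R c] 1 by simp
    qed
    then show ?thesis
      by (rule leads_trans) (use c(2) in \<open>auto intro!: leads_now\<close>)
  qed
  have scan: "leads B R (2 * k + 10, ?I4 ?f, Z') (\<lambda>(l, _, _). l = (if ?b then E else E + 3))"
    if Z': "\<forall>i. i \<noteq> 2 \<longrightarrow> Z' i = ?Z i" for Z'
  proof -
    let ?Z1 = "Z'(1 := real n)" and ?Z2 = "Z'(1 := real n, 2 := 1)"
    let ?Z3 = "Z'(1 := 0, 2 := 1)"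
    let ?J = "(?I4 ?f)(3 := n + 2, 5 := 1)"
    let ?s = "if n = 2 \<and> ?f then s1 else s0"
    \<comment> \<open>The length \<open>n\<close> is restored from behind the input, since register
      1 held the unit during the index tests.\<close>
    have 1: "step B R (2 * k + 10, ?I4 ?f, Z') = (2 * k + 11, ?I4 ?f, ?Z1)"
      unfolding step.simps reducer_nth_middle using Z' N xs(4) by simp
    have 2: "step B R (2 * k + 11, ?I4 ?f, ?Z1) = (2 * k + 12, ?I4 ?f, ?Z2)"
      unfolding step.simps reducer_nth_middle by simp
    have 3: "step B R (2 * k + 15, (?I4 ?f)(3 := n + 1), ?Z3)
        = (2 * k + 16, (?I4 ?f)(3 := n + 2), ?Z3)"
      unfolding step.simps reducer_nth_middle by simp
    have 4: "step B R (2 * k + 16, (?I4 ?f)(3 := n + 2), ?Z3) = (2 * k + 17, ?J, ?Z3)"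
      unfolding step.simps reducer_nth_middle by simp
    \<comment> \<open>The address \<open>n + 2\<close> equals 4 exactly for \<open>n = 2\<close> and
      never equals 1.\<close>
    have 5: "step B R (2 * k + 17, ?J, ?Z3) = (D + 4 * ?s, ?J, ?Z3)"
      unfolding step.simps reducer_nth_middle using xs(4) by (cases ?f) auto
    have J: "?J 3 = n + 2" "?J 2 = n + 2 + length cs"
      using N by simp_all
    have "map ?Z3 [?J 3..<?J 2] = cs"
      unfolding J
    proof (rule nth_equalityI)
      fix i assume "i < length (map ?Z3 [n + 2..<n + 2 + length cs])"
      then have i: "i < length cs" by (simp del: upt_Suc)
      then have "map ?Z3 [n + 2..<n + 2 + length cs] ! i = ?Z3 (n + 2 + i)"
        by (simp del: upt_Suc)
      also have "\<dots> = load xs (n + 2 + i)"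
        using i N Z' xs(4) by simp
      also have "\<dots> = cs ! i"
        using i xs(2,3) N by (simp add: load_def nth_append)
      finally show "map ?Z3 [n + 2..<n + 2 + length cs] ! i = cs ! i" .
    qed (simp del: upt_Suc)
    moreover have "leads B R (D + 4 * ?s, ?J, ?Z3) (\<lambda>(l, _, _).
        l = (if acc (foldl (\<lambda>s b. \<delta> s (b = 0)) ?s (map ?Z3 [?J 3..<?J 2])) then E else E + 3))"
      by (rule reducer_automaton) (use start_states N xs(4) in auto)
    ultimately have automaton: "leads B R (D + 4 * ?s, ?J, ?Z3) (\<lambda>(l, _, _). l = (if ?b then E else E + 3))"
      by simp
    have skip: "leads B R (2 * k + 12, ?I4 ?f, ?Z2)
        (\<lambda>c. c = (2 * k + 15, (?I4 ?f)(3 := (?I4 ?f) 3 + n), ?Z2(1 := 0)))"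
      by (rule reducer_skip) (use xs(4) in auto)
    have skipped: "(2 * k + 15, (?I4 ?f)(3 := (?I4 ?f) 3 + n), ?Z2(1 := 0))
        = (2 * k + 15, (?I4 ?f)(3 := n + 1), ?Z3)"
      by auto
    show ?thesis
    proof (rule leads_step, subst 1, rule leads_step, subst 2, rule leads_trans[OF skip])
      fix c :: config assume "c = (2 * k + 15, (?I4 ?f)(3 := (?I4 ?f) 3 + n), ?Z2(1 := 0))"
      then have c: "c = (2 * k + 15, (?I4 ?f)(3 := n + 1), ?Z3)"
        unfolding skipped .
      show "leads B R c (\<lambda>(l, _, _). l = (if ?b then E else E + 3))"
        unfolding c
        by (rule leads_step, subst 3, rule leads_step, subst 4, rule leads_step, subst 5)
          (rule automaton)
    qed
  qed
  show ?thesis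
    unfolding computes_iff_leads
  proof (rule leads_trans[OF start])
    fix c :: config assume c: "c = (6, ?I, ?Z)"
    show "leads B R c (\<lambda>(l, I, Z). R ! l = Stop \<and> [if ?b then 1 else 0] = contents I Z)"
      unfolding c
    proof (rule leads_trans[OF leads_trans[OF tests select]])
      fix c :: config assume "case c of (l, I', Z') \<Rightarrow>
        l = 2 * k + 10 \<and> I' = ?I4 ?f \<and> (\<forall>i. i \<noteq> 2 \<longrightarrow> Z' i = ?Z i)"
      moreover obtain l I' Z' where c': "c = (l, I', Z')"
        by (cases c)
      ultimately have c: "c = (2 * k + 10, ?I4 ?f, Z')" "\<forall>i. i \<noteq> 2 \<longrightarrow> Z' i = ?Z i"
        unfolding c' prod.case by blast+
      show "leads B R c (\<lambda>(l, I, Z). R ! l = Stop \<and> [if ?b then 1 else 0] = contents I Z)"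
        unfolding c(1)
      proof (rule leads_trans[OF scan[OF c(2)]])
        fix c :: config assume "case c of (l, _, _) \<Rightarrow> l = (if ?b then E else E + 3)"
        moreover obtain l I Z where c': "c = (l, I, Z)"
          by (cases c)
        ultimately have c: "c = (l, I, Z)" "l = (if ?b then E else E + 3)"
          unfolding c' prod.case by blast+
        show "leads B R c (\<lambda>(l, I, Z). R ! l = Stop \<and> [if ?b then 1 else 0] = contents I Z)"
          unfolding c(1) by (rule reducer_answer[OF c(2)])
      qed
    qed
  qed
qed

end

section \<open>The hierarchy\<close>

text \<open>
  States of the parser: \<open>s \<le> 10\<close> ones of an opcode have been read; \<open>10 + r\<close> means that \<open>r \<ge> 1\<close> operands
  of the current instruction remain; 15 is the trap entered on the opcode of \<open>IfNonneg\<close>.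
\<close>

definition field_count :: "nat \<Rightarrow> nat" where
  "field_count c = [0, 3, 3, 2, 3, 3, 2, 1, 1, 4, 2] ! c"

text \<open>Operands are unbounded, but only their terminating zeros matter, so counting the
  remaining operands takes finitely many states; \<open>field_count\<close> lists the number of
  operands by opcode.\<close>

definition parse_step :: "nat \<Rightarrow> bool \<Rightarrow> nat" where
  "parse_step s z = (
     if s \<le> 10 then
       if \<not> z then (if s < 10 then Suc s else 15)
       else if s = 5 then 15 else if field_count s = 0 then 0 else 10 + field_count s
     else if s = 15 then 15
     else if \<not> z then s else if s = 11 then 0 else s - 1)"

abbreviation parse :: "nat \<Rightarrow> real list \<Rightarrow> nat" where
  "parse \<equiv> foldl (\<lambda>s b. parse_step s (b = 0))"

lemma nat_le_10_cases: "(s::nat) \<le> 10 \<Longrightarrow>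
    s = 0 \<or> s = 1 \<or> s = 2 \<or> s = 3 \<or> s = 4 \<or> s = 5 \<or> s = 6 \<or> s = 7 \<or> s = 8 \<or> s = 9 \<or> s = 10"
  by presburger

lemma parse_step_less: "s < 16 \<Longrightarrow> parse_step s z < 16"
proof (cases "s \<le> 10")
  case True
  show ?thesis
    using nat_le_10_cases[OF True] by (elim disjE) (simp_all add: parse_step_def field_count_def)
qed (auto simp: parse_step_def)

lemma parse_15: "parse 15 bs = 15"
  by (induction bs) (simp_all add: parse_step_def)

lemma parse_opcode: "s + n \<le> 10 \<Longrightarrow> parse s (nat_code n) = parse_step (s + n) True"
  by (induction n arbitrary: s) (simp_all add: nat_code_def parse_step_def)

lemma parse_field: "10 < s \<Longrightarrow> s < 15 \<Longrightarrow> parse s (nat_code n) = (if s = 11 then 0 else s - 1)"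
  by (induction n) (simp_all add: nat_code_def parse_step_def)

lemma parse_step_opcode:
  "parse_step 0 True = 0" "parse_step (Suc 0) True = 13" "parse_step (Suc (Suc 0)) True = 13"
  "parse_step 3 True = 12" "parse_step 4 True = 13" "parse_step 5 True = 15"
  "parse_step 6 True = 12" "parse_step 7 True = 11" "parse_step 8 True = 11"
  "parse_step 9 True = 14" "parse_step 10 True = 12"
  by (simp_all add: parse_step_def field_count_def)

lemma parse_instr:
  "parse 0 (concat (map nat_code (instr_fields a))) = (if \<exists>j l1 l2. a = IfNonneg j l1 l2 then 15 else 0)"
  by (cases a) (simp_all add: parse_opcode parse_field parse_15 parse_step_opcode)

text \<open>State 0 marks instruction boundaries, so instructions are parsed one by one, and the
  trap 15 is absorbing.\<close>

lemma parse_code: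
  "parse 0 (code p) = (if \<exists>j l1 l2. IfNonneg j l1 l2 \<in> set p then 15 else 0)"
proof (induction p)
  case Nil
  show ?case by (simp add: code_def)
next
  case (Cons a p)
  have "parse 0 (code (a # p)) = parse (parse 0 (concat (map nat_code (instr_fields a)))) (code p)"
    by (simp add: code_def)
  then show ?case
    using Cons.IH by (auto simp: parse_instr parse_15)
qed

section \<open>Comparison of a bit string with a fixed word\<close>

text \<open>A state is the number of matched symbols; \<open>Suc (length w)\<close> is a sink for a
  mismatch or an overlong word.\<close>

definition match_step :: "real list \<Rightarrow> nat \<Rightarrow> bool \<Rightarrow> nat" where
  "match_step w i z = (if i < length w \<and> (w ! i = 0 \<longleftrightarrow> z) then Suc i else Suc (length w))"

abbreviation match :: "real list \<Rightarrow> nat \<Rightarrow> real list \<Rightarrow> nat" where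
  "match w \<equiv> foldl (\<lambda>s b. match_step w s (b = 0))"

lemma match_fail: "match w (Suc (length w)) bs = Suc (length w)"
  by (induction bs) (simp_all add: match_step_def)

lemma match_step_le: "match_step w i z \<le> Suc (length w)"
  by (simp add: match_step_def)

text \<open>The automaton sees only whether an entry is zero; on words over 0 and 1 this determines
  the entry.\<close>

lemma match_iff:
  assumes "set w \<subseteq> {0, 1}" "set bs \<subseteq> {0, 1}" "i \<le> length w"
  shows "match w i bs = length w \<longleftrightarrow> bs = drop i w"
  using assms(2,3)
proof (induction bs arbitrary: i)
  case Nil
  then show ?case by auto
next
  case (Cons b bs)
  show ?case
  proof (cases "i < length w")
    case True
    then have w: "drop i w = w ! i # drop (Suc i) w"
      by (simp add: Cons_nth_drop_Suc)
    have "w ! i \<in> {0, 1}" "b \<in> {0, 1}"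
      using True assms(1) Cons.prems(1) nth_mem by (blast, auto)
    then have "(w ! i = 0 \<longleftrightarrow> b = 0) \<longleftrightarrow> b = w ! i" by auto
    then have "match_step w i (b = 0) = (if b = w ! i then Suc i else Suc (length w))"
      using True by (simp add: match_step_def)
    then show ?thesis
      using True w Cons.IH[of "Suc i"] Cons.prems by (simp add: match_fail)
  next
    case False
    then have "match_step w i (b = 0) = Suc (length w)"
      by (simp add: match_step_def)
    then show ?thesis
      using False Cons.prems by (simp add: match_fail)
  qed
qed

text \<open>Product automaton coded in one number: the residue modulo 16 is the state of the
  16-state parser, the quotient that of the matcher.\<close>

definition pair_step :: "real list \<Rightarrow> nat \<Rightarrow> bool \<Rightarrow> nat" where
  "pair_step w s z = parse_step (s mod 16) z + 16 * match_step w (s div 16) z"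

lemma foldl_pair_step:
  assumes "s < 16"
  shows "foldl (\<lambda>s b. pair_step w s (b = 0)) (s + 16 * t) bs = parse s bs + 16 * match w t bs
    \<and> parse s bs < 16"
  using assms
  by (induction bs arbitrary: s t) (simp_all add: pair_step_def parse_step_less)

text \<open>
  The second component of the start state \<open>16 * (length w + 1)\<close> is the failure state of the matcher,
  so that only inputs with \<open>n = 2\<close> and an admissible index can be accepted as codes of \<open>\<K>\<close>.
\<close>

definition H_reducer :: "nat \<Rightarrow> bool \<Rightarrow> prog" where
  "H_reducer k all = (let w = code machine_K in
     reducer k all (16 * (length w + 2)) (pair_step w)
       (\<lambda>s. s mod 16 = 0 \<or> s div 16 = length w) (16 * (length w + 1)) 0)"

lemma pair_step_less: "pair_step w s z < 16 * (length w + 2)"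
proof -
  have "parse_step (s mod 16) z < 16"
    by (simp add: parse_step_less)
  moreover have "16 * match_step w (s div 16) z \<le> 16 * Suc (length w)"
    using match_step_le by (rule mult_le_mono2)
  ultimately show ?thesis
    by (simp add: pair_step_def)
qed

lemma H_reducer_in_M1_add_oracle: "H_reducer k all \<in> M1_add_oracle"
  unfolding H_reducer_def Let_def
  by (rule reducer_in_M1_add_oracle) (use pair_step_less in auto)

lemma H_reducer_not_mem:
  assumes "xs \<noteq> []" "xs \<notin> B"
  shows "computes B (H_reducer k all) xs [0]"
  unfolding H_reducer_def Let_def
  by (rule reducer_computes_not_mem) (use pair_step_less assms in auto)

lemma H_reducer_mem:
  assumes "real n # ys @ code p \<in> B" "length ys = n" "n \<ge> 1"
  shows "computes B (H_reducer k all) (real n # ys @ code p)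
    [if (\<nexists>j l1 l2. IfNonneg j l1 l2 \<in> set p) \<or>
        n = 2 \<and> (all \<or> (\<exists>j\<in>{1..k}. hd ys = real j)) \<and> code p = code machine_K
     then 1 else 0]"
proof -
  let ?w = "code machine_K"
  let ?acc = "\<lambda>s. s mod 16 = 0 \<or> s div 16 = length ?w"
  let ?f = "n = 2 \<and> (all \<or> (\<exists>j\<in>{1..k}. hd ys = real j))"
  let ?s = "if ?f then 0 else 16 * (length ?w + 1)"
  let ?t = "if ?f then 0 else Suc (length ?w)"
  let ?end = "foldl (\<lambda>s b. pair_step ?w s (b = 0)) ?s (code p)"
  have "?s = 0 + 16 * ?t" by simp
  then have "?end = parse 0 (code p) + 16 * match ?w ?t (code p)" "parse 0 (code p) < 16"
    using foldl_pair_step[of 0 ?w ?t "code p"] by simp_all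
  then have "?end mod 16 = parse 0 (code p)" "?end div 16 = match ?w ?t (code p)"
    by simp_all
  moreover have "parse 0 (code p) = 0 \<longleftrightarrow> (\<nexists>j l1 l2. IfNonneg j l1 l2 \<in> set p)"
    by (simp add: parse_code)
  moreover have "match ?w ?t (code p) = length ?w \<longleftrightarrow> ?f \<and> code p = ?w"
    using match_iff[OF set_code set_code, of 0 machine_K p] by (simp add: match_fail)
  ultimately have acc: "?acc ?end \<longleftrightarrow> (\<nexists>j l1 l2. IfNonneg j l1 l2 \<in> set p) \<or> ?f \<and> code p = ?w"
    by simp
  have "computes B (H_reducer k all) (real n # ys @ code p) [if ?acc ?end then 1 else 0]"
    unfolding H_reducer_def Let_def
    by (rule reducer_computes_mem) (use pair_step_less assms in auto)
  then show ?thesis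
    unfolding acc by (simp only: conj_assoc)
qed

section \<open>Unique decoding of programs\<close>

text \<open>The zero terminates the block of ones, so this is a prefix code.\<close>

lemma nat_code_inject:
  assumes "nat_code m @ xs = nat_code n @ ys"
  shows "m = n \<and> xs = ys"
  using assms
proof (induction m arbitrary: n)
  case 0
  then show ?case by (cases n) (auto simp: nat_code_def)
next
  case (Suc m)
  then show ?case by (cases n) (auto simp: nat_code_def)
qed

lemma nat_codes_inject: "concat (map nat_code ms) = concat (map nat_code ns) \<Longrightarrow> ms = ns"
proof (induction ms arbitrary: ns)
  case Nil
  then show ?case by (cases ns) (auto simp: nat_code_def)
next
  case (Cons m ms)
  then obtain n ns' where ns: "ns = n # ns'"
    by (cases ns) (auto simp: nat_code_def)
  then show ?case
    using Cons nat_code_inject[of m _ n] by auto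
qed

text \<open>The opcode fixes the number of operands. All nonzero constants share the field 1, whence
  the restriction to 0 and 1.\<close>

lemma instr_fields_inject:
  assumes "instr_fields a @ ms = instr_fields b @ ns"
    and "\<And>j c. a = SetConst j c \<Longrightarrow> c \<in> {0, 1}" "\<And>j c. b = SetConst j c \<Longrightarrow> c \<in> {0, 1}"
  shows "a = b \<and> ms = ns"
  using assms by (cases a; cases b) (auto split: if_splits)

text \<open>The automaton compares codes, whereas halting concerns programs; the reduction of the
  union passes from one to the other.\<close>

lemma code_inject:
  assumes "p \<in> M1_add_oracle" "q \<in> M1_add_oracle" "code p = code q"
  shows "p = q"
proof -
  have fields: "concat (map instr_fields p) = concat (map instr_fields q)"
    using assms(3) nat_codes_inject by (simp add: code_def)
  have constants: "\<forall>j c. SetConst j c \<in> set p \<longrightarrow> c \<in> {0, 1}" "\<forall>j c. SetConst j c \<in> set q \<longrightarrow> c \<in> {0, 1}"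
    using assms(1,2) by (auto simp: M1_add_oracle_def)
  from fields constants show ?thesis
  proof (induction p arbitrary: q)
    case Nil
    have "instr_fields a \<noteq> []" for a by (cases a) auto
    then show ?case
      using Nil by (cases q) auto
  next
    case (Cons a p)
    have "instr_fields a \<noteq> []" by (cases a) auto
    then obtain b q' where q: "q = b # q'"
      using Cons.prems(1) by (cases q) auto
    have "a = b \<and> concat (map instr_fields p) = concat (map instr_fields q')"
      by (rule instr_fields_inject) (use Cons.prems q in auto)
    then show ?case
      using Cons q by auto
  qed
qed

section \<open>Reductions between the sets of the hierarchy\<close>

lemma IfNonneg_in_machine_K: "\<exists>j l1 l2. IfNonneg j l1 l2 \<in> set machine_K"
  by (auto simp: machine_K_def)

lemma H1_eq_addE:
  assumes "xs \<in> H1_eq_add"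
  obtains n ys p where "xs = real n # ys @ code p" "length ys = n" "n \<ge> 1" "p \<in> M1_add"
    "\<nexists>j l1 l2. IfNonneg j l1 l2 \<in> set p" "halts_on p ys"
  using assms unfolding H1_eq_add_def halting_problem_def M1_eq_add_def by blast

text \<open>The first entry determines where the code begins, and \<open>parse_code\<close> reads
  the presence of an order test off the code, so no program without order tests can share
  it.\<close>

lemma not_H1_eq_add:
  assumes "length ys = n" "\<exists>j l1 l2. IfNonneg j l1 l2 \<in> set p"
  shows "real n # ys @ code p \<notin> H1_eq_add"
proof
  assume "real n # ys @ code p \<in> H1_eq_add"
  then obtain n' ys' p' where eq: "real n # ys @ code p = real n' # ys' @ code p'" "length ys' = n'"
    and p': "\<nexists>j l1 l2. IfNonneg j l1 l2 \<in> set p'"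
    by (elim H1_eq_addE)
  from eq assms(1) have "code p = code p'" by simp
  then show False
    using assms(2) p' parse_code[of p] parse_code[of p'] by simp
qed

lemma P_set_iff: "xs \<in> P_set j \<longleftrightarrow>
    (\<exists>x. xs = real 2 # [real j, x] @ code machine_K \<and> x \<noteq> sqrt (real (nth_prime j)))"
  by (auto simp: P_set_def)

lemma P_set_not_H1_eq_add: "xs \<in> P_set j \<Longrightarrow> xs \<notin> H1_eq_add"
  unfolding P_set_iff using not_H1_eq_add[OF _ IfNonneg_in_machine_K, of "[real j, x]" 2 for x] by auto

lemma P_set_index_unique: "xs \<in> P_set i \<Longrightarrow> xs \<in> P_set j \<Longrightarrow> i = j"
  by (auto simp: P_set_iff)

lemma H_mono: "i \<le> j \<Longrightarrow> H i \<subseteq> H j"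
  by (force simp: H_def)

lemma UN_H_eq: "(\<Union>i\<in>{1..}. H i) = H1_eq_add \<union> (\<Union>j\<in>{1..}. P_set j)"
  by (force simp: H_def)

text \<open>After a positive answer, an input whose program has no order test lies in
  \<open>H1_eq_add\<close>, and any other in some \<open>P_set j\<close>; the condition
  \<open>j \<le> k\<close> is then decided by \<open>k\<close> hard-wired comparisons.\<close>

lemma H_reducible:
  assumes "H k \<subseteq> B" "B \<subseteq> (\<Union>i\<in>{1..}. H i)"
  shows "H k \<preceq> B"
  unfolding reducible_def
proof (intro bexI[of _ "H_reducer k False"] allI impI H_reducer_in_M1_add_oracle)
  fix xs :: "real list" assume "xs \<noteq> []"
  show "computes B (H_reducer k False) xs [if xs \<in> H k then 1 else 0]"
  proof (cases "xs \<in> B")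
    case False
    then show ?thesis
      using H_reducer_not_mem[OF \<open>xs \<noteq> []\<close>] assms(1) by auto
  next
    case True
    then consider "xs \<in> H1_eq_add" | j where "j \<ge> 1" "xs \<in> P_set j"
      using assms(2) unfolding UN_H_eq by auto
    then show ?thesis
    proof cases
      case 1
      then have "xs \<in> H k" by (simp add: H_def)
      from 1 obtain n ys p where "xs = real n # ys @ code p" "length ys = n" "n \<ge> 1"
        "\<nexists>j l1 l2. IfNonneg j l1 l2 \<in> set p"
        by (elim H1_eq_addE)
      then show ?thesis
        using H_reducer_mem[of n ys p B k False] True \<open>xs \<in> H k\<close> by simp
    next
      case 2
      then obtain x where x: "xs = real 2 # [real j, x] @ code machine_K"
        by (auto simp: P_set_iff)
      have "xs \<in> H k \<longleftrightarrow> j \<in> {1..k}"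
        using 2 P_set_not_H1_eq_add[OF 2(2)] P_set_index_unique[OF 2(2)] unfolding H_def by blast
      then show ?thesis
        using H_reducer_mem[of 2 "[real j, x]" machine_K B k False] True x IfNonneg_in_machine_K
        by simp
    qed
  qed
qed

lemma UN_H_subset_H1_add: "(\<Union>i\<in>{1..}. H i) \<subseteq> H1_add"
proof -
  have "xs \<in> H1_add" if "j \<ge> 1" "xs \<in> P_set j" for j xs
  proof -
    obtain x where "xs = real 2 # [real j, x] @ code machine_K" "x \<noteq> sqrt (real (nth_prime j))"
      using \<open>xs \<in> P_set j\<close> by (auto simp: P_set_iff)
    then show ?thesis
      using K_halts_iff[OF \<open>j \<ge> 1\<close>, of x] machine_K_in_M1_add
      unfolding H1_add_def halting_problem_def
      by (intro CollectI exI[of _ 2] exI[of _ "[real j, x]"] exI[of _ machine_K]) simp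
  qed
  moreover have "H1_eq_add \<subseteq> H1_add"
    unfolding H1_eq_add_def H1_add_def halting_problem_def M1_eq_add_def by blast
  ultimately show ?thesis
    unfolding UN_H_eq by auto
qed

text \<open>A positive answer certifies halting. For the code of \<open>machine_K\<close> with two
  inputs this forces a positive integer index and a real different from the root, so code and arity
  alone decide acceptance; hence \<open>k = 0\<close> and \<open>all = True\<close>.\<close>

lemma UN_H_reducible: "(\<Union>i\<in>{1..}. H i) \<preceq> H1_add"
  unfolding reducible_def
proof (intro bexI[of _ "H_reducer 0 True"] allI impI H_reducer_in_M1_add_oracle)
  fix xs :: "real list" assume "xs \<noteq> []"
  let ?U = "\<Union>i\<in>{1..}. H i"
  show "computes H1_add (H_reducer 0 True) xs [if xs \<in> ?U then 1 else 0]"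
  proof (cases "xs \<in> H1_add")
    case False
    then show ?thesis
      using H_reducer_not_mem[OF \<open>xs \<noteq> []\<close> False] UN_H_subset_H1_add by auto
  next
    case True
    then obtain n ys p where xs: "xs = real n # ys @ code p" "length ys = n" "n \<ge> 1"
      and p: "p \<in> M1_add" "halts_on p ys"
      unfolding H1_add_def halting_problem_def by blast
    have "xs \<in> ?U \<longleftrightarrow> (\<nexists>j l1 l2. IfNonneg j l1 l2 \<in> set p) \<or> n = 2 \<and> code p = code machine_K"
    proof
      assume "xs \<in> ?U"
      then consider "xs \<in> H1_eq_add" | j where "xs \<in> P_set j"
        unfolding UN_H_eq by blast
      then show "(\<nexists>j l1 l2. IfNonneg j l1 l2 \<in> set p) \<or> n = 2 \<and> code p = code machine_K"
      proof cases
        case 1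
        then show ?thesis
          using not_H1_eq_add[OF xs(2), of p] xs(1) by blast
      next
        case 2
        then obtain x where "xs = real 2 # [real j, x] @ code machine_K"
          by (auto simp: P_set_iff)
        then have "real n # ys @ code p = real 2 # [real j, x] @ code machine_K"
          using xs(1) by simp
        then have "n = 2" by simp
        moreover have "code p = code machine_K"
          using \<open>real n # ys @ code p = _\<close> xs(2) \<open>n = 2\<close> 
          by (auto simp: length_Suc_conv numeral_2_eq_2)
        ultimately show ?thesis by blast
      qed
    next
      assume "(\<nexists>j l1 l2. IfNonneg j l1 l2 \<in> set p) \<or> n = 2 \<and> code p = code machine_K"
      then show "xs \<in> ?U"
      proof
        assume "\<nexists>j l1 l2. IfNonneg j l1 l2 \<in> set p"
        then have "p \<in> M1_eq_add"
          using p(1) by (simp add: M1_eq_add_def)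
        then have "xs \<in> H1_eq_add"
          using xs p(2) unfolding H1_eq_add_def halting_problem_def by blast
        then show ?thesis
          unfolding UN_H_eq by blast
      next
        assume K: "n = 2 \<and> code p = code machine_K"
        then have "p = machine_K"
          using code_inject p(1) machine_K_in_M1_add by (simp add: M1_add_def)
        obtain a x where ys: "ys = [a, x]"
          using xs(2) K by (auto simp: length_Suc_conv numeral_2_eq_2)
        have halts: "halts_on machine_K [a, x]"
          using p(2) \<open>p = machine_K\<close> ys by simp
        then obtain j where j: "j \<ge> 1" "a = real j"
          using K_not_halts_if_not_index[of a x] by blast
        have "xs = real 2 # [real j, x] @ code machine_K"
          using xs(1) ys K j(2) by simp
        moreover have "x \<noteq> sqrt (real (nth_prime j))"
          using halts K_halts_iff[OF j(1), of x] j(2) by simp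
        ultimately have "xs \<in> P_set j"
          unfolding P_set_iff by blast
        then show ?thesis
          unfolding UN_H_eq using j(1) by auto
      qed
    qed
    then show ?thesis
      using H_reducer_mem[of n ys p H1_add 0 True] True xs by simp
  qed
qed

text \<open>The upper bound on \<open>B\<close> excludes the root, as \<open>P_set (Suc k)\<close>
  is the only one that can contain such an input; the lower bound supplies all other
  \<open>x\<close>.\<close>

lemma machine_K_input_mem_iff:
  assumes "B \<subseteq> (\<Union>i\<in>{1..}. H i)" "H (Suc k) \<subseteq> B"
  shows "[2, real (Suc k), x] @ code machine_K \<in> B \<longleftrightarrow> x \<noteq> sqrt (real (nth_prime (Suc k)))"
proof -
  let ?xs = "real 2 # [real (Suc k), x] @ code machine_K"
  have "?xs \<notin> H1_eq_add"
    by (rule not_H1_eq_add) (simp_all add: IfNonneg_in_machine_K)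
  moreover have P: "?xs \<in> P_set j \<longleftrightarrow> j = Suc k \<and> x \<noteq> sqrt (real (nth_prime (Suc k)))" for j
    by (auto simp: P_set_iff simp del: of_nat_Suc)
  ultimately have "?xs \<in> B \<Longrightarrow> x \<noteq> sqrt (real (nth_prime (Suc k)))"
    using assms(1) unfolding UN_H_eq by blast
  moreover have "?xs \<in> H (Suc k)" if "x \<noteq> sqrt (real (nth_prime (Suc k)))"
    unfolding H_def using P[of "Suc k"] that by auto
  ultimately have "?xs \<in> B \<longleftrightarrow> x \<noteq> sqrt (real (nth_prime (Suc k)))"
    using assms(2) by blast
  then show ?thesis by simp
qed

theorem theorem4p15:
  shows "H1_eq_add = H 0
    \<and> (\<forall>k. H k \<prec> H (Suc k))
    \<and> (\<forall>k. H k \<prec> (\<Union>i\<in>{1..}. H i))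
    \<and> (\<Union>i\<in>{1..}. H i) \<preceq> H1_add"
proof (intro conjI allI)
  show "H1_eq_add = H 0"
    by (simp add: H_def)
next
  fix k
  have "H (Suc k) \<subseteq> (\<Union>i\<in>{1..}. H i)"
    by auto
  then have "\<not> H (Suc k) \<preceq> H k"
    by (intro not_reducible_to_H machine_K_input_mem_iff) auto
  moreover have "H k \<preceq> H (Suc k)"
    by (intro H_reducible H_mono) auto
  ultimately show "H k \<prec> H (Suc k)"
    by (simp add: strictly_reducible_def)
next
  fix k
  have "H (Suc k) \<subseteq> (\<Union>i\<in>{1..}. H i)"
    by auto
  then have "\<not> (\<Union>i\<in>{1..}. H i) \<preceq> H k"
    by (intro not_reducible_to_H machine_K_input_mem_iff) auto
  moreover have "H k \<preceq> (\<Union>i\<in>{1..}. H i)"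
  proof (rule H_reducible)
    \<comment> \<open>The union starts at index 1, so \<open>H 0\<close> is not one of its listed
      members; \<open>H (Suc k)\<close> always is.\<close>
    show "H k \<subseteq> (\<Union>i\<in>{1..}. H i)"
      using H_mono[of k "Suc k"] by auto
  qed auto
  ultimately show "H k \<prec> (\<Union>i\<in>{1..}. H i)"
    by (simp add: strictly_reducible_def)
qed (rule UN_H_reducible)

end
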